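(* Consider the autonomous system (S) of state deviations $\widetilde{\bm x}=\bm x-\bm x^*\in\mathbb{R}^{3n_H-1}$ described in the context, and suppose that assumptions (1)–(7) listed in the context hold. Then the synchronous state $\bm x^*$ is locally asymptotically stable, i.e. for every $\epsilon>0$ there exists a $\delta>0$ (depending on $\epsilon$) such that, if $\|\widetilde{\bm x}(0)\|<\delta$, then the solution satisfies $$\|\widetilde{\bm x}(t,0,\bm x_0)\|<\epsilon\quad\text{for all } t>0,\qquad\text{and}\qquad \lim_{t\to\infty}\bm x(t,0,\bm x_0)=\bm x^*.$$
   Context: **Network.** $\mathcal V_H=\mathcal L_5\cup\mathcal L_4\cup\mathcal L_3$ (disjoint) is the node set of a rooted tree with $n_H=111$ nodes: $\mathcal L_5$ consists of the root, $\mathcal L_4$ of its 10 children, and $\mathcal L_3$ of 100 nodes, 10 children for each node of $\mathcal L_4$. $\mathcal E$ is the (symmetric) set of pairs of adjacent nodes; $\sum_{(j,i)\in\mathcal E}$ (for fixed $i$) is the sum over the neighbours $j\in\mathcal V_H$ of $i$. $\mathcal N_i^{\rm high}$ is the set of neighbours of $i$ in the next higher level (the parent of $i$; empty for the root). Line susceptances are $b_{ij}$, conductances $g_{ij}$; $b_{ij}=0$ if $(i,j)\notin\mathcal E$. Write $\theta_{ij}=\theta_i-\theta_j$. $P_i,Q_i$ ($i\in\mathcal V_H$) are real constants (net active and reactive power supply minus load). **Dynamics.** For $i\in\mathcal V_H$, with zero control inputs, $$\dot\theta_i=\omega_i,\quad m_i\dot\omega_i=-d_i\omega_i+P_i-\sum_{j\in\mathcal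 V_H}P_{i,j}(\theta,v),\quad \tau_i\dot v_i=-k_iv_i+Q_i-\sum_{j\in\mathcal V_H}Q_{i,j}(\theta,v),$$ $$P_{i,j}=v_iv_j[g_{ij}\cos\theta_{ij}+b_{ij}\sin\theta_{ij}],\quad Q_{i,j}=v_iv_j[g_{ij}\sin\theta_{ij}-b_{ij}\cos\theta_{ij}].$$ A synchronous state $\bm x^*$, with components $(\theta_i^*,\omega_i^*,v_i^* )$, is an equilibrium: $\omega_i^*=0$, $\sum_{(j,i)\in\mathcal E}P_{i,j}(\theta^*,v^* )=P_i$, $\sum_{(j,i)\in\mathcal E}Q_{i,j}(\theta^*,v^* )=Q_i-k_iv_i^*$ for all $i$. It is assumed to exist and is fixed. **Deviations and system (S).** A reference node $g\in\mathcal L_3$ is fixed, with $\theta_g=\theta_g^*$ at all times, so $\widetilde\theta_g=0$. Put $\widetilde\theta_i=\theta_i-\theta_i^*$ ($i\ne g$), $\widetilde\omega_i=\omega_i$, $\widetilde v_i=v_i-v_i^*$ ($i\in\mathcal V_H$), and let $\widetilde{\bm x}\in\mathbb{R}^{3n_H-1}$ be the vector of all $\widetilde\theta_i$ ($i\neq g$), $\widetilde\omega_i,\widetilde v_i$ ($i\in\mathcal V_H$). System (S) is $\frac{d}{dt}\widetilde{\bm x}=\bm f(\widetilde{\bm x})$, $\widetilde{\bm x}(0)=\bm x_0-\bm x^*$, where $\bm f$ is given by the equations above for $\dot\theta_i$ ($i\ne g$), $\dot\omega_i,\dot v_i$ ($i\in\mathcal V_H$) with $\theta_g\equiv\theta_g^*$;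 $\bm f(\bm 0)=\bm 0$. $\bm x(t,0,\bm x_0)$ is the state at time $t$ with initial state $\bm x_0$ at time $0$, and $\widetilde{\bm x}(t,0,\bm x_0)=\bm x(t,0,\bm x_0)-\bm x^*$. $\|\cdot\|$ is the Euclidean norm (and the induced matrix norm). **Assumptions.** (1) The network is connected and lossless: $b_{ij}=b_{ji}>0$ for $(i,j)\in\mathcal E$, $b_{ii}=0$, and $g_{ij}=0$ for all $i,j$. (2) $|\theta_i^*-\theta_j^*|<\pi/2$ for all $(i,j)\in\mathcal E$. (3) $m_i,d_i,\tau_i,k_i,v_i^*>0$ for all $i\in\mathcal V_H$, and $m_i>m_j>m_k$ for all $i\in\mathcal L_5$, $j\in\mathcal L_4$, $k\in\mathcal L_3$. (4) Matrices: $\bm V_{\omega\omega}=\mathrm{diag}(m_i)\in\mathbb{R}^{n_H\times n_H}$; $\bm V_{\theta\theta}\in\mathbb{R}^{(n_H-1)\times(n_H-1)}$ indexed by $i,j\in\mathcal V_H\setminus\{g\}$ with $\bm V_{\theta\theta}(i,i)=\sum_{(j,i)\in\mathcal E}b_{ij}v_i^*v_j^*\cos\theta_{ij}^*$ (the sum includes $j=g$ if adjacent) and $\bm V_{\theta\theta}(i,j)=-b_{ij}v_i^*v_j^*\cos\theta_{ij}^*$ for $i\ne j$; $\bm V_{vv}\in\mathbb{R}^{n_H\times n_H}$ with $\bm V_{vv}(i,i)=Q_i/(v_i^* )^2$ and $\bm V_{vv}(i,j)=-b_{ij}\cos\theta_{ij}^*$ for $i\neq j$; $\bm V_{\theta v}\in\mathbb{R}^{(n_H-1)\times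 n_H}$ with rows $i\in\mathcal V_H\setminus\{g\}$, columns $j\in\mathcal V_H$, $\bm V_{\theta v}(i,i)=\sum_{(j,i)\in\mathcal E}b_{ij}v_j^*\sin\theta_{ij}^*$ and $\bm V_{\theta v}(i,j)=b_{ij}v_i^*\sin\theta_{ij}^*$ for $i\ne j$. (5) With $$U(\bm\theta,\bm v)=\sum_{i\in\mathcal V_H}\Big(-P_i\theta_i+k_iv_i-Q_i\ln v_i-\sum_{j\in\mathcal N_i^{\rm high}}b_{ij}v_iv_j\cos\theta_{ij}\Big),$$ $$V(\widetilde{\bm x})=\sum_{i\in\mathcal V_H}\tfrac12m_i\widetilde\omega_i^2+U(\bm\theta^*+\widetilde{\bm\theta},\bm v^*+\widetilde{\bm v})-U(\bm\theta^*,\bm v^* ),$$ there is a constant $L>0$ with $\|\nabla^2V(\bm x)-\nabla^2V(\bm y)\|\le L\|\bm x-\bm y\|$ for all $\bm x,\bm y$ in the ball $\{\|\widetilde{\bm x}\|\le r\}$, with $r$ as in (7) (on this ball $V$ is well defined and $C^2$). (6) With $$C_1=\sum_{i\in\mathcal V_H}\Big[\Big(\sum_{(j,i)\in\mathcal E}b_{ij}v_j^*\sin\theta_{ij}^*\Big)^2+\sum_{(j,i)\in\mathcal E}(b_{ij}v_i^*\sin\theta_{ij}^* )^2\Big],$$ $$C=\min_{i\in\mathcal V_H}\Big(\frac{Q_i}{(v_i^* )^2}-\sum_{(j,i)\in\mathcal E}b_{ij}\cos\theta_{ij}^*\Big)\lambda_{\min}(\bm V_{\theta\theta}),$$ one has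 $C>C_1>0$. (7) $r$ is chosen with $0<r<3\lambda_{\min}(\nabla^2V(\bm 0))/L$. With it one sets $c_1=\frac12\lambda_{\min}(\nabla^2V(\bm 0))-\frac{Lr}{6}$, $c_2=\frac12\lambda_{\max}(\nabla^2V(\bm 0))+\frac{Lr}{6}$, $\delta(\epsilon)=\sqrt{c_1/c_2}\,\min\{\epsilon,r\}$. *)

theory Defs
  imports "HOL-Analysis.Analysis"
begin

definition real_eigenvalues :: "real^'k^'k \<Rightarrow> real set" where
  "real_eigenvalues A = {c. \<exists>x. x \<noteq> 0 \<and> A *v x = c *\<^sub>R x}"

text \<open>Meaningful for symmetric matrices; all matrices it is used for are symmetric.\<close>

definition lambda_min :: "real^'k^'k \<Rightarrow> real" where
  "lambda_min A = Min (real_eigenvalues A)"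

definition partial_deriv :: "'k::finite \<Rightarrow> (real^'k \<Rightarrow> real) \<Rightarrow> real^'k \<Rightarrow> real" where
  "partial_deriv i F x = deriv (\<lambda>h. F (x + h *\<^sub>R axis i 1)) 0"

definition hessian :: "(real^'k \<Rightarrow> real) \<Rightarrow> real^'k \<Rightarrow> real^'k^'k" where
  "hessian F x = (\<chi> i j. partial_deriv i (partial_deriv j F) x)"

record 'a power_network =
  L5 :: "'a set"
  L4 :: "'a set"
  L3 :: "'a set"
  edges :: "('a \<times> 'a) set"
  suscept :: "'a \<Rightarrow> 'a \<Rightarrow> real"  \<comment> \<open>\<open>b\<^sub>i\<^sub>j\<close>\<close>
  conduct :: "'a \<Rightarrow> 'a \<Rightarrow> real"  \<comment> \<open>\<open>g\<^sub>i\<^sub>j\<close>\<close>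
  inertia :: "'a \<Rightarrow> real"  \<comment> \<open>\<open>m\<^sub>i\<close>\<close>
  damping :: "'a \<Rightarrow> real"  \<comment> \<open>\<open>d\<^sub>i\<close>\<close>
  volt_time :: "'a \<Rightarrow> real"  \<comment> \<open>\<open>\<tau>\<^sub>i\<close>\<close>
  volt_droop :: "'a \<Rightarrow> real"  \<comment> \<open>\<open>k\<^sub>i\<close>\<close>
  netP :: "'a \<Rightarrow> real"  \<comment> \<open>\<open>P\<^sub>i\<close>\<close>
  netQ :: "'a \<Rightarrow> real"  \<comment> \<open>\<open>Q\<^sub>i\<close>\<close>

definition nbrs :: "'a power_network \<Rightarrow> 'a \<Rightarrow> 'a set" where
  "nbrs N i = {j. (j, i) \<in> edges N}"

definition hierarchical_tree :: "'a power_network \<Rightarrow> bool" where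
  "hierarchical_tree N \<longleftrightarrow>
     L5 N \<union> L4 N \<union> L3 N = UNIV \<and>
     L5 N \<inter> L4 N = {} \<and> L5 N \<inter> L3 N = {} \<and> L4 N \<inter> L3 N = {} \<and>
     card (L5 N) = 1 \<and> card (L4 N) = 10 \<and> card (L3 N) = 100 \<and>
     sym (edges N) \<and>
     edges N \<subseteq> L5 N \<times> L4 N \<union> L4 N \<times> L5 N \<union> L4 N \<times> L3 N \<union> L3 N \<times> L4 N \<and>
     L5 N \<times> L4 N \<subseteq> edges N \<and>
     (\<forall>k\<in>L3 N. \<exists>!j. j \<in> L4 N \<and> (j, k) \<in> edges N) \<and>
     (\<forall>j\<in>L4 N. card {k \<in> L3 N. (j, k) \<in> edges N} = 10)"

definition nbrs_high :: "'a power_network \<Rightarrow> 'a \<Rightarrow> 'a set" where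
  "nbrs_high N i =
     {j \<in> nbrs N i. (i \<in> L4 N \<and> j \<in> L5 N) \<or> (i \<in> L3 N \<and> j \<in> L4 N)}"

definition flowP ::
  "'a power_network \<Rightarrow> ('a \<Rightarrow> real) \<Rightarrow> ('a \<Rightarrow> real) \<Rightarrow> 'a \<Rightarrow> 'a \<Rightarrow> real" where
  "flowP N \<theta> v i j =
     v i * v j * (conduct N i j * cos (\<theta> i - \<theta> j) + suscept N i j * sin (\<theta> i - \<theta> j))"

definition flowQ ::
  "'a power_network \<Rightarrow> ('a \<Rightarrow> real) \<Rightarrow> ('a \<Rightarrow> real) \<Rightarrow> 'a \<Rightarrow> 'a \<Rightarrow> real" where
  "flowQ N \<theta> v i j =
     v i * v j * (conduct N i j * sin (\<theta> i - \<theta> j) - suscept N i j * cos (\<theta> i - \<theta> j))"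

definition synchronous_state ::
  "'a power_network \<Rightarrow> ('a \<Rightarrow> real) \<Rightarrow> ('a \<Rightarrow> real) \<Rightarrow> ('a \<Rightarrow> real) \<Rightarrow> bool" where
  "synchronous_state N \<theta> \<omega> v \<longleftrightarrow>
     (\<forall>i. \<omega> i = 0 \<and>
          (\<Sum>j\<in>nbrs N i. flowP N \<theta> v i j) = netP N i \<and>
          (\<Sum>j\<in>nbrs N i. flowQ N \<theta> v i j) = netQ N i - volt_droop N i * v i)"

text \<open>The node type is \<open>'m option\<close> with \<open>None\<close> the reference node, whose phase angle is frozen
  (its frequency and voltage are not); \<open>'m\<close> indexes the remaining nodes. Every finite set with a
  distinguished element is of this form, and the state space is exactly the Euclidean space of
  dimension \<open>3 * CARD('m option) - 1\<close>. The coordinates of the reduced state are the phase angles of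
  the nodes \<open>Some k\<close>, followed by all frequencies and all voltages.\<close>

type_synonym 'm state_index = "'m + ('m option + 'm option)"
type_synonym 'm state = "real ^ 'm state_index"

definition state_vec ::
  "('m option \<Rightarrow> real) \<Rightarrow> ('m option \<Rightarrow> real) \<Rightarrow> ('m option \<Rightarrow> real) \<Rightarrow> 'm::finite state" where
  "state_vec \<theta> \<omega> v =
     (\<chi> a. case a of Inl k \<Rightarrow> \<theta> (Some k) | Inr (Inl i) \<Rightarrow> \<omega> i | Inr (Inr i) \<Rightarrow> v i)"

definition theta_of :: "'m::finite state \<Rightarrow> 'm option \<Rightarrow> real" where
  "theta_of x i = (case i of None \<Rightarrow> 0 | Some k \<Rightarrow> x $ Inl k)"

definition omega_of :: "'m::finite state \<Rightarrow> 'm option \<Rightarrow> real" where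
  "omega_of x i = x $ Inr (Inl i)"

definition volt_of :: "'m::finite state \<Rightarrow> 'm option \<Rightarrow> real" where
  "volt_of x i = x $ Inr (Inr i)"

text \<open>The argument \<open>x\<close> is the vector of deviations from the synchronous state with phase angles
  \<open>\<theta>s\<close> and voltages \<open>vs\<close> (its frequencies vanish).\<close>

definition vector_field ::
  "'m option power_network \<Rightarrow> ('m option \<Rightarrow> real) \<Rightarrow> ('m option \<Rightarrow> real)
     \<Rightarrow> 'm::finite state \<Rightarrow> 'm state" where
  "vector_field N \<theta>s vs x =
     (let \<theta> = (\<lambda>i. \<theta>s i + theta_of x i);
          \<omega> = omega_of x;
          v = (\<lambda>i. vs i + volt_of x i)
      in state_vec
           \<omega>
           (\<lambda>i. (- damping N i * \<omega> i + netP N i - (\<Sum>j\<in>UNIV. flowP N \<theta> v i j)) / inertia N i)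
           (\<lambda>i. (- volt_droop N i * v i + netQ N i - (\<Sum>j\<in>UNIV. flowQ N \<theta> v i j))
                  / volt_time N i))"

definition solution_from ::
  "'m option power_network \<Rightarrow> ('m option \<Rightarrow> real) \<Rightarrow> ('m option \<Rightarrow> real) \<Rightarrow> ('m option \<Rightarrow> real)
     \<Rightarrow> 'm::finite state \<Rightarrow> (real \<Rightarrow> 'm state) \<Rightarrow> bool" where
  "solution_from N \<theta>s \<omega>s vs x0 x \<longleftrightarrow>
     x 0 = x0 \<and>
     (\<forall>t\<ge>0. ((\<lambda>t. x t - state_vec \<theta>s \<omega>s vs) has_vector_derivative
                vector_field N \<theta>s vs (x t - state_vec \<theta>s \<omega>s vs)) (at t within {0..}))"

definition potential ::
  "'a::finite power_network \<Rightarrow> ('a \<Rightarrow> real) \<Rightarrow> ('a \<Rightarrow> real) \<Rightarrow> real" where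
  "potential N \<theta> v =
     (\<Sum>i\<in>UNIV. - netP N i * \<theta> i + volt_droop N i * v i - netQ N i * ln (v i)
        - (\<Sum>j\<in>nbrs_high N i. suscept N i j * v i * v j * cos (\<theta> i - \<theta> j)))"

definition energy ::
  "'m option power_network \<Rightarrow> ('m option \<Rightarrow> real) \<Rightarrow> ('m option \<Rightarrow> real)
     \<Rightarrow> 'm::finite state \<Rightarrow> real" where
  "energy N \<theta>s vs x =
     (\<Sum>i\<in>UNIV. 1/2 * inertia N i * (omega_of x i)\<^sup>2)
     + potential N (\<lambda>i. \<theta>s i + theta_of x i) (\<lambda>i. vs i + volt_of x i)
     - potential N \<theta>s vs"

definition V_theta_theta ::
  "'m option power_network \<Rightarrow> ('m option \<Rightarrow> real) \<Rightarrow> ('m option \<Rightarrow> real)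
     \<Rightarrow> real^'m::finite^'m" where
  "V_theta_theta N \<theta>s vs =
     (\<chi> i j. if i = j
        then \<Sum>l\<in>nbrs N (Some i).
               suscept N (Some i) l * vs (Some i) * vs l * cos (\<theta>s (Some i) - \<theta>s l)
        else - (suscept N (Some i) (Some j) * vs (Some i) * vs (Some j)
                 * cos (\<theta>s (Some i) - \<theta>s (Some j))))"

definition coupling_C1 ::
  "'a::finite power_network \<Rightarrow> ('a \<Rightarrow> real) \<Rightarrow> ('a \<Rightarrow> real) \<Rightarrow> real" where
  "coupling_C1 N \<theta>s vs =
     (\<Sum>i\<in>UNIV. (\<Sum>j\<in>nbrs N i. suscept N i j * vs j * sin (\<theta>s i - \<theta>s j))\<^sup>2
               + (\<Sum>j\<in>nbrs N i. (suscept N i j * vs i * sin (\<theta>s i - \<theta>s j))\<^sup>2))"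

definition coupling_C ::
  "'m option power_network \<Rightarrow> ('m option \<Rightarrow> real) \<Rightarrow> ('m::finite option \<Rightarrow> real) \<Rightarrow> real" where
  "coupling_C N \<theta>s vs =
     Min (range (\<lambda>i. netQ N i / (vs i)\<^sup>2
                      - (\<Sum>j\<in>nbrs N i. suscept N i j * cos (\<theta>s i - \<theta>s j))))
     * lambda_min (V_theta_theta N \<theta>s vs)"

end

theory Submission
  imports Defs
begin

text \<open>The positive radius condition forces the Hessian of the energy at the synchronous state to be
  positive definite. The linearised system is a damped second-order flow in the angles, a gradient
  flow in the voltages, and the reference frequency driven by both; a quadratic form built from
  the Hessian (with a cross term between angles and frequencies and a small weight on the reference
  frequency) decreases strictly along it. This form is therefore a strict Lyapunov function of the
  nonlinear system near the equilibrium, which gives stability and exponential convergence, and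
  keeps solutions inside a ball where the vector field may be replaced by a bounded, globally
  Lipschitz one, so that they exist for all time.\<close>

section \<open>Symmetric matrices and quadratic forms\<close>

text \<open>The energy dissipates only through frequencies and voltage gradients. Even apart from
  the reference node its decay is therefore merely semidefinite and yields no rate. All strictness
  comes from one principle, \<open>finsler_perturb_pos\<close>: a nonnegative form becomes positive
  definite when a small multiple of a form that is positive at its nonzero zeros is added. It is
  used three times: to keep the form positive in spite of the cross term, to make the dissipation
  definite in angles and voltages, and to include the reference frequency. The order of choice
  matters: \<beta> is fixed before \<kappa>, because the product of reference frequency and
  reference force has no sign and is absorbed by the decay in the angles, which exists only once the
  cross term is there. Every constant comes from compactness of the unit sphere. The nonlinearity
  enters only through a remainder of smaller order at the equilibrium, which costs half of the
  decay.\<close>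

lemma eigenvectors_orthogonal:
  fixes A :: "real^'k^'k"
  assumes sym: "\<And>x y. x \<bullet> (A *v y) = (A *v x) \<bullet> y"
    and "A *v x = c *\<^sub>R x" "A *v y = d *\<^sub>R y" "c \<noteq> d"
  shows "x \<bullet> y = 0"
proof -
  have "d * (x \<bullet> y) = c * (x \<bullet> y)"
    using sym[of x y] assms(2,3) by simp
  then show ?thesis using \<open>c \<noteq> d\<close> by simp
qed

text \<open>\<open>lambda_min\<close> is a \<open>Min\<close>, which is a lower bound only over a
  finite set. Orthogonal nonzero eigenvectors are independent, so one eigenvector per eigenvalue
  gives an injection into a finite set.\<close>

lemma finite_real_eigenvalues:
  fixes A :: "real^'k^'k"
  assumes sym: "\<And>x y. x \<bullet> (A *v y) = (A *v x) \<bullet> y"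
  shows "finite (real_eigenvalues A)"
proof -
  define e where "e c = (SOME x. x \<noteq> 0 \<and> A *v x = c *\<^sub>R x)" for c
  have e: "e c \<noteq> 0 \<and> A *v e c = c *\<^sub>R e c" if "c \<in> real_eigenvalues A" for c
    using that unfolding real_eigenvalues_def e_def mem_Collect_eq by (rule someI_ex)
  have orth: "e c \<bullet> e d = 0" if "c \<in> real_eigenvalues A" "d \<in> real_eigenvalues A" "c \<noteq> d" for c d
    using eigenvectors_orthogonal[OF sym] e that by metis
  have inj: "inj_on e (real_eigenvalues A)"
    by (rule inj_onI) (metis e orth inner_eq_zero_iff)
  have "independent (e ` real_eigenvalues A)"
    by (rule pairwise_orthogonal_independent) (use e orth in \<open>auto simp: pairwise_def orthogonal_def\<close>)
  then have "finite (e ` real_eigenvalues A)"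
    using independent_imp_finite by blast
  then show ?thesis
    using inj finite_imageD by blast
qed

text \<open>The Rayleigh quotient attains its minimum on the unit sphere, and a minimiser \<open>u\<close> is an
  eigenvector: the form of \<open>A - \<mu>\<close> is nonnegative and vanishes at \<open>u\<close>, so \<open>u\<close> lies in its radical.\<close>

lemma symmetric_pos_def:
  fixes A :: "real^'k^'k"
  assumes sym: "\<And>x y. x \<bullet> (A *v y) = (A *v x) \<bullet> y"
    and pos: "0 < lambda_min A" and "x \<noteq> 0"
  shows "0 < x \<bullet> (A *v x)"
proof -
  have cont: "continuous_on (sphere 0 1) (\<lambda>x. x \<bullet> (A *v x))"
    by (intro continuous_intros linear_continuous_on matrix_vector_mul_bounded_linear)
  have "x /\<^sub>R norm x \<in> sphere 0 1" using \<open>x \<noteq> 0\<close> by simp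
  then have "sphere (0::real^'k) 1 \<noteq> {}" by blast
  then obtain u where u: "u \<in> sphere 0 1"
    and min: "\<And>y. y \<in> sphere 0 1 \<Longrightarrow> u \<bullet> (A *v u) \<le> y \<bullet> (A *v y)"
    using continuous_attains_inf[OF compact_sphere _ cont] by blast
  define \<mu> where "\<mu> = u \<bullet> (A *v u)"
  have ge: "\<mu> * (y \<bullet> y) \<le> y \<bullet> (A *v y)" for y
  proof (cases "y = 0")
    case False
    then have "\<mu> \<le> (y /\<^sub>R norm y) \<bullet> (A *v (y /\<^sub>R norm y))"
      unfolding \<mu>_def by (intro min) simp
    also have "\<dots> = (y \<bullet> (A *v y)) / (y \<bullet> y)"
      by (simp add: matrix_vector_mult_scaleR divide_simps dot_square_norm power2_eq_square)
    finally show ?thesis using False by (simp add: pos_le_divide_eq)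
  qed simp
  define w where "w = A *v u - \<mu> *\<^sub>R u"
  have uu: "u \<bullet> u = 1" using u by (simp add: dot_square_norm)
  have "w \<bullet> w = 0"
  proof (rule ccontr)
    assume "w \<bullet> w \<noteq> 0"
    then have ww: "w \<bullet> w > 0" by simp
    define c where "c = w \<bullet> (A *v w) - \<mu> * (w \<bullet> w)"
    have c: "c \<ge> 0" using ge[of w] by (simp add: c_def)
    have Au: "A *v u = w + \<mu> *\<^sub>R u" by (simp add: w_def)
    have uAw: "u \<bullet> (A *v w) = w \<bullet> w + \<mu> * (u \<bullet> w)"
      by (simp add: sym Au inner_add_left)
    have uw: "u \<bullet> w = 0"
      by (simp add: w_def inner_diff_right uu \<mu>_def[symmetric])
    have quad: "0 \<le> t\<^sup>2 * c - 2 * t * (w \<bullet> w)" for t :: real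
    proof -
      have "\<mu> * ((u - t *\<^sub>R w) \<bullet> (u - t *\<^sub>R w)) \<le> (u - t *\<^sub>R w) \<bullet> (A *v (u - t *\<^sub>R w))"
        by (rule ge)
      then show ?thesis
        using uu uw uAw
        by (simp add: matrix_vector_mult_diff_distrib matrix_vector_mult_scaleR inner_diff_left
            inner_diff_right Au inner_add_right inner_commute[of w u] c_def power2_eq_square
            algebra_simps)
    qed
    \<comment> \<open>The form of \<open>A - \<mu>\<close> at \<open>u - t *\<^sub>R w\<close> is
      \<open>t\<^sup>2 * c - 2 * t * (w \<bullet> w)\<close>. This \<open>t\<close> is so small that
      the linear term wins; the 1 in the denominator covers \<open>c = 0\<close>.\<close>
    define t where "t = (w \<bullet> w) / (c + 1)"
    have t: "t > 0" using ww c by (simp add: t_def)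
    have "t * c \<le> w \<bullet> w" using ww c by (simp add: t_def field_simps)
    have "t\<^sup>2 * c - 2 * t * (w \<bullet> w) = t * (t * c - 2 * (w \<bullet> w))"
      by (simp add: power2_eq_square algebra_simps)
    also have "\<dots> < 0" using t ww \<open>t * c \<le> w \<bullet> w\<close> by (intro mult_pos_neg) linarith+
    finally show False using quad[of t] by simp
  qed
  then have "A *v u = \<mu> *\<^sub>R u" by (simp add: w_def)
  moreover have "u \<noteq> 0" using uu by auto
  ultimately have "\<mu> \<in> real_eigenvalues A" by (auto simp: real_eigenvalues_def)
  then have "lambda_min A \<le> \<mu>"
    unfolding lambda_min_def by (intro Min_le finite_real_eigenvalues sym)
  then have "0 < \<mu> * (x \<bullet> x)" using pos \<open>x \<noteq> 0\<close> by simp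
  then show ?thesis using ge[of x] by linarith
qed

text \<open>Weaker than the usual notion: only continuity and homogeneity of degree two are
  recorded, which is what reduces a claim about all nonzero vectors to the compact unit
  sphere.\<close>

definition quadratic_form :: "('a::real_normed_vector \<Rightarrow> real) \<Rightarrow> bool" where
  "quadratic_form P \<longleftrightarrow> continuous_on UNIV P \<and> (\<forall>c x. P (c *\<^sub>R x) = c\<^sup>2 * P x)"

lemma quadratic_form_inner:
  assumes f: "bounded_linear f" and g: "bounded_linear g"
  shows "quadratic_form (\<lambda>x. f x \<bullet> g x)"
proof -
  have "continuous_on UNIV f" "continuous_on UNIV g"
    using f g linear_continuous_on by blast+
  then show ?thesis
    unfolding quadratic_form_def
    using linear_cmul[OF bounded_linear.linear[OF f]] linear_cmul[OF bounded_linear.linear[OF g]]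
    by (auto simp: power2_eq_square intro!: continuous_on_inner)
qed

lemma quadratic_form_mult:
  fixes f g :: "'a::real_normed_vector \<Rightarrow> real"
  shows "bounded_linear f \<Longrightarrow> bounded_linear g \<Longrightarrow> quadratic_form (\<lambda>x. f x * g x)"
  using quadratic_form_inner[of f g] by simp

lemma quadratic_form_add:
  "quadratic_form P \<Longrightarrow> quadratic_form R \<Longrightarrow> quadratic_form (\<lambda>x. P x + R x)"
  by (auto simp: quadratic_form_def algebra_simps intro!: continuous_intros)

lemma quadratic_form_cmult:
  "quadratic_form P \<Longrightarrow> quadratic_form (\<lambda>x. c * P x)"
  by (auto simp: quadratic_form_def algebra_simps intro!: continuous_intros)

lemma quadratic_form_sum:
  "(\<And>i. i \<in> I \<Longrightarrow> quadratic_form (P i)) \<Longrightarrow> quadratic_form (\<lambda>x. \<Sum>i\<in>I. P i x)"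
  by (auto simp: quadratic_form_def sum_distrib_left intro!: continuous_intros)

lemma quadratic_form_pos_bound:
  fixes P :: "'a::euclidean_space \<Rightarrow> real"
  assumes "quadratic_form P" and pos: "\<And>x. x \<noteq> 0 \<Longrightarrow> 0 < P x"
  obtains c where "c > 0" "\<And>x. c * (norm x)\<^sup>2 \<le> P x"
proof -
  have hom: "P (c *\<^sub>R x) = c\<^sup>2 * P x" for c x using assms by (simp add: quadratic_form_def)
  have cont: "continuous_on (sphere 0 1) P"
    using assms by (auto simp: quadratic_form_def intro: continuous_on_subset)
  obtain b :: 'a where "b \<in> Basis" using nonempty_Basis by blast
  then have "sphere (0::'a) 1 \<noteq> {}" by force
  then obtain u where u: "u \<in> sphere 0 1" and min: "\<And>y. y \<in> sphere 0 1 \<Longrightarrow> P u \<le> P y"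
    using continuous_attains_inf[OF compact_sphere _ cont] by blast
  show ?thesis
  proof
    show "P u > 0" using u by (intro pos) auto
    show "P u * (norm x)\<^sup>2 \<le> P x" for x
    proof (cases "x = 0")
      case True
      then show ?thesis using hom[of 0 0] by simp
    next
      case False
      then have "P u \<le> P (x /\<^sub>R norm x)" by (intro min) simp
      then show ?thesis using False by (simp add: hom field_simps)
    qed
  qed
qed

text \<open>The perturbation can only hurt on the part \<open>K\<close> of the unit sphere where
  \<open>R\<close> is nonpositive. There \<open>P\<close> has no zero, so by compactness it exceeds
  a positive constant, while \<open>R\<close> is bounded. The bound serves all smaller weights too,
  so that two such bounds can later be met by one weight.\<close>

lemma finsler_perturb_pos:
  fixes P R :: "'a::euclidean_space \<Rightarrow> real"
  assumes P: "quadratic_form P" and R: "quadratic_form R"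
    and nonneg: "\<And>x. 0 \<le> P x" and pos: "\<And>x. x \<noteq> 0 \<Longrightarrow> P x = 0 \<Longrightarrow> 0 < R x"
  obtains b where "b > 0" "\<And>c x. 0 < c \<Longrightarrow> c \<le> b \<Longrightarrow> x \<noteq> 0 \<Longrightarrow> 0 < P x + c * R x"
proof -
  have contP: "continuous_on S P" and contR: "continuous_on S R" for S
    using P R by (auto simp: quadratic_form_def intro: continuous_on_subset)
  define K where "K = sphere 0 1 \<inter> {x. R x \<le> 0}"
  have "closed {x. R x \<le> 0}" by (intro closed_Collect_le contR continuous_intros)
  then have "compact K" unfolding K_def by (intro compact_Int_closed) auto
  have "bounded (R ` sphere 0 1)"
    using compact_imp_bounded compact_continuous_image[OF contR compact_sphere] by blast
  then obtain M where M: "M > 0" "\<And>x. x \<in> sphere 0 1 \<Longrightarrow> norm (R x) \<le> M"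
    using bounded_pos by (metis imageI)
  have "\<exists>b>0. \<forall>x\<in>K. b * M < P x"
  proof (cases "K = {}")
    case False
    then obtain u where u: "u \<in> K" and min: "\<And>y. y \<in> K \<Longrightarrow> P u \<le> P y"
      using continuous_attains_inf[OF \<open>compact K\<close> _ contP] by blast
    have "u \<noteq> 0" "\<not> 0 < R u" using u by (auto simp: K_def)
    then have "P u \<noteq> 0" using pos by blast
    then have "P u > 0" using nonneg[of u] by linarith
    have "(P u / (2 * M)) * M < P x" if "x \<in> K" for x
      using min[OF that] \<open>P u > 0\<close> M(1) by simp
    moreover have "P u / (2 * M) > 0" using \<open>P u > 0\<close> M(1) by simp
    ultimately show ?thesis by blast
  qed (auto intro: exI[of _ 1])
  then obtain b where b: "b > 0" "\<And>x. x \<in> K \<Longrightarrow> b * M < P x" by blast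
  have sph: "0 < P x + c * R x" if c: "0 < c" "c \<le> b" and x: "x \<in> sphere 0 1" for c x
  proof (cases "x \<in> K")
    case True
    have "\<bar>c * R x\<bar> \<le> b * M"
      unfolding abs_mult using M(2)[OF x] c M(1) by (intro mult_mono) auto
    then show ?thesis using b(2)[OF True] by linarith
  next
    case False
    then have "R x > 0" using x by (auto simp: K_def)
    then show ?thesis using nonneg[of x] c by (simp add: add_nonneg_pos)
  qed
  show ?thesis
  proof (rule that[OF b(1)])
    fix c and x :: 'a
    assume c: "0 < c" "c \<le> b" and x: "x \<noteq> 0"
    have "0 < P (x /\<^sub>R norm x) + c * R (x /\<^sub>R norm x)"
      using x by (intro sph c) simp
    also have "\<dots> = (P x + c * R x) / (norm x)\<^sup>2"
      using P R by (simp add: quadratic_form_def divide_inverse power_inverse algebra_simps)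
    finally show "0 < P x + c * R x"
      using x by (simp add: zero_less_divide_iff)
  qed
qed

section \<open>Global solutions and Lyapunov stability\<close>

lemma integral_has_vector_derivative_atLeast:
  fixes h :: "real \<Rightarrow> 'a::banach"
  assumes "continuous_on UNIV h" "t \<ge> 0"
  shows "((\<lambda>t. integral {0..t} h) has_vector_derivative h t) (at t within {0..})"
proof -
  have "((\<lambda>t. integral {0..t} h) has_vector_derivative h t) (at t within {0..t+1})"
    using assms continuous_on_subset by (intro integral_has_vector_derivative) auto
  moreover have "at t within {0..t+1} = at t within {0..}"
    by (rule at_within_nhd[where S="{..<t+1}"]) auto
  ultimately show ?thesis by simp
qed

text \<open>Picard iteration is a contraction on all of \<open>[0,\<infinity>)\<close> in the norm weighted by
  \<open>exp (-2 K t)\<close>; the unknown \<open>g\<close> is the solution multiplied by this weight.\<close>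

lemma lipschitz_ode_global_solution:
  fixes f :: "'a::euclidean_space \<Rightarrow> 'a"
  assumes lip: "\<And>x y. norm (f x - f y) \<le> K * norm (x - y)" and K: "K > 0"
    and bound: "\<And>x. norm (f x) \<le> M"
  obtains x where "x 0 = x0"
    "\<And>t. t \<ge> 0 \<Longrightarrow> (x has_vector_derivative f (x t)) (at t within {0..})"
proof -
  have contf: "continuous_on UNIV f"
    by (rule lipschitz_on_continuous_on[where L=K], rule lipschitz_onI) (use lip K in \<open>auto simp: dist_norm\<close>)
  \<comment> \<open>The factor \<open>exp (2 * K * s)\<close> undoes the weight carried by
    \<open>g\<close>, so \<open>f\<close> is evaluated at the candidate solution itself.\<close>
  define h where "h g s = f (exp (2 * K * s) *\<^sub>R apply_bcontfun g s)" for g s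
  \<comment> \<open>Bounded continuous functions live on the whole real line; \<open>max 0 t\<close>
    extends the iterate to negative times by its value at 0.\<close>
  define F where "F g t = exp (-2*K*max 0 t) *\<^sub>R (x0 + integral {0..max 0 t} (h g))" for g t
  have conth: "continuous_on S (h g)" for S g
    unfolding h_def
    by (rule continuous_on_compose2[OF contf]) (auto intro!: continuous_intros)
  have conti: "continuous_on {0..} (\<lambda>t. integral {0..t} (h g))" for g
    by (rule continuous_on_vector_derivative[OF integral_has_vector_derivative_atLeast]) (auto intro: conth)
  have contF: "continuous_on UNIV (F g)" for g
    unfolding F_def
    by (intro continuous_intros continuous_on_compose2[OF conti]) auto
  have hint: "h g integrable_on {0..t}" for g t
    by (intro integrable_continuous_real conth)
  have "M \<ge> 0" using bound[of 0] norm_ge_zero order_trans by blast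
  \<comment> \<open>The iterate must stay in the space of bounded functions. As \<open>f\<close> is
    bounded, the integral grows at most linearly, and \<tau> times the weight is at most
    \<open>1 / (2*K)\<close>.\<close>
  have boundF: "norm (F g t) \<le> norm x0 + M / (2*K)" for g t
  proof -
    define \<tau> where "\<tau> = max 0 t"
    have \<tau>: "\<tau> \<ge> 0" by (simp add: \<tau>_def)
    have "norm (integral {0..\<tau>} (h g)) \<le> integral {0..\<tau>} (\<lambda>s. M)"
      by (intro integral_norm_bound_integral hint) (auto simp: h_def bound)
    then have 1: "norm (integral {0..\<tau>} (h g)) \<le> \<tau> * M" using \<tau> by simp
    have "1 + 2*K*\<tau> \<le> exp (2*K*\<tau>)" by (rule exp_ge_add_one_self)
    then have "2*K*\<tau> \<le> exp (2*K*\<tau>)" by linarith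
    then have 2: "\<tau> \<le> exp (2*K*\<tau>) / (2*K)" using K by (simp add: pos_le_divide_eq mult.commute)
    have "norm (F g t) \<le> exp (-2*K*\<tau>) * (norm x0 + \<tau> * M)"
      unfolding F_def \<tau>_def[symmetric] using 1 norm_triangle_ineq[of x0 "integral {0..\<tau>} (h g)"]
      by (auto intro!: mult_left_mono)
    also have "\<dots> \<le> exp (-2*K*\<tau>) * (exp (2*K*\<tau>) * norm x0 + exp (2*K*\<tau>) / (2*K) * M)"
      using 2 \<open>M \<ge> 0\<close> \<tau> K mult_right_mono[of 1 "exp (2*K*\<tau>)" "norm x0"]
      by (intro mult_left_mono add_mono mult_right_mono) auto
    also have "\<dots> = norm x0 + M / (2*K)"
      by (simp add: exp_minus field_simps)
    finally show ?thesis .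
  qed
  define \<Phi> where "\<Phi> g = Bcontfun (F g)" for g
  have \<Phi>: "apply_bcontfun (\<Phi> g) = F g" for g
    unfolding \<Phi>_def using bcontfun_normI[OF contF boundF] by (simp add: Bcontfun_inverse)
  have "dist (\<Phi> g1) (\<Phi> g2) \<le> 1/2 * dist g1 g2" for g1 g2
  proof (rule dist_bound)
    fix t :: real
    define \<tau> where "\<tau> = max 0 t"
    have \<tau>: "\<tau> \<ge> 0" by (simp add: \<tau>_def)
    define D where "D = dist g1 g2"
    \<comment> \<open>Integrating the inverse weight gains a factor \<open>1 / (2*K)\<close>, which
      turns the Lipschitz constant \<open>K\<close> into the contraction factor 1/2. This is the
      origin of the 2 in the exponent.\<close>
    have hi: "((\<lambda>s. exp (2 * K * s) * (K * D)) has_integral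
        exp (2*K*\<tau>) * (D/2) - exp (2*K*0) * (D/2)) {0..\<tau>}"
    proof (rule fundamental_theorem_of_calculus[OF \<tau>])
      show "((\<lambda>s. exp (2 * K * s) * (D/2)) has_vector_derivative exp (2 * K * s) * (K * D)) (at s within {0..\<tau>})" for s
        unfolding has_real_derivative_iff_has_vector_derivative[symmetric]
        by (auto intro!: derivative_eq_intros)
    qed
    have "norm (integral {0..\<tau>} (\<lambda>s. h g1 s - h g2 s)) \<le> integral {0..\<tau>} (\<lambda>s. exp (2 * K * s) * (K * D))"
    proof (intro integral_norm_bound_integral integrable_diff hint)
      show "(\<lambda>s. exp (2 * K * s) * (K * D)) integrable_on {0..\<tau>}" using hi by blast
      fix s
      have "norm (h g1 s - h g2 s) \<le> K * norm (exp (2 * K * s) *\<^sub>R apply_bcontfun g1 s - exp (2 * K * s) *\<^sub>R apply_bcontfun g2 s)"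
        unfolding h_def by (rule lip)
      also have "\<dots> = K * (exp (2 * K * s) * dist (apply_bcontfun g1 s) (apply_bcontfun g2 s))"
        by (simp add: scaleR_diff_right[symmetric] dist_norm del: scaleR_diff_right)
      also have "\<dots> \<le> K * (exp (2 * K * s) * D)"
        unfolding D_def using K by (intro mult_left_mono dist_bounded) auto
      finally show "norm (h g1 s - h g2 s) \<le> exp (2 * K * s) * (K * D)" by (simp add: algebra_simps)
    qed
    also have "\<dots> = exp (2*K*\<tau>) * (D/2) - D/2" using integral_unique[OF hi] by simp
    also have "\<dots> \<le> exp (2*K*\<tau>) * (D/2)" by (simp add: D_def)
    finally have "norm (integral {0..\<tau>} (h g1) - integral {0..\<tau>} (h g2)) \<le> exp (2*K*\<tau>) * (D/2)"
      by (simp add: integral_diff[OF hint hint])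
    then have *: "exp (-2*K*\<tau>) * norm (integral {0..\<tau>} (h g1) - integral {0..\<tau>} (h g2)) \<le> exp (-2*K*\<tau>) * (exp (2*K*\<tau>) * (D/2))"
      by (intro mult_left_mono) auto
    have "exp (-2*K*\<tau>) * exp (2*K*\<tau>) = 1" by (simp add: exp_minus)
    then have **: "exp (-2*K*\<tau>) * (exp (2*K*\<tau>) * (D/2)) = 1/2 * dist g1 g2"
      unfolding mult.assoc[symmetric] D_def by simp
    have "dist (apply_bcontfun (\<Phi> g1) t) (apply_bcontfun (\<Phi> g2) t)
        = norm (exp (-2*K*\<tau>) *\<^sub>R (integral {0..\<tau>} (h g1) - integral {0..\<tau>} (h g2)))"
      unfolding dist_norm by (simp add: \<Phi> F_def \<tau>_def scaleR_diff_right scaleR_add_right)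
    also have "\<dots> = exp (-2*K*\<tau>) * norm (integral {0..\<tau>} (h g1) - integral {0..\<tau>} (h g2))"
      by simp
    also note *
    also note **
    finally show "dist (apply_bcontfun (\<Phi> g1) t) (apply_bcontfun (\<Phi> g2) t) \<le> 1/2 * dist g1 g2" .
  qed
  then have "\<exists>!g. \<Phi> g = g"
    by (intro banach_fix_type[of "1/2"]) simp_all
  then obtain g where gfix: "\<Phi> g = g" by blast
  have g: "apply_bcontfun g t = F g t" for t
    using arg_cong[OF gfix, of "\<lambda>g. apply_bcontfun g t"] \<Phi>[of g] by simp
  define x where "x t = x0 + integral {0..t} (h g)" for t
  have hx: "h g t = f (x t)" if "t \<ge> 0" for t
  proof -
    have "exp (2*K*t) *\<^sub>R F g t = x t" using that by (simp add: F_def x_def exp_minus)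
    then show ?thesis by (simp only: h_def g)
  qed
  show ?thesis
  proof
    show "x 0 = x0" by (simp add: x_def)
    fix t :: real
    assume t: "t \<ge> 0"
    have "(x has_vector_derivative 0 + h g t) (at t within {0..})"
      unfolding x_def
      by (intro has_vector_derivative_add has_vector_derivative_const
          integral_has_vector_derivative_atLeast conth t)
    then show "(x has_vector_derivative f (x t)) (at t within {0..})" using hx[OF t] by simp
  qed
qed

text \<open>As long as the trajectory is in the ball, \<open>W (y t) * exp (\<eta> * t)\<close> has
  a nonpositive derivative, so one application of the mean value theorem gives the bound.\<close>

lemma lyapunov_exponential_decay:
  fixes y :: "real \<Rightarrow> 'a::real_normed_vector" and W :: "'a \<Rightarrow> real"
  assumes deriv: "\<And>t. t \<ge> 0 \<Longrightarrow> (y has_vector_derivative F (y t)) (at t within {0..})"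
    and W': "\<And>x. (W has_derivative W' x) (at x)"
    and decay: "\<And>x. norm x \<le> \<rho> \<Longrightarrow> W' x (F x) \<le> - \<eta> * W x"
    and T: "T \<ge> 0" and inside: "\<And>t. 0 \<le> t \<Longrightarrow> t \<le> T \<Longrightarrow> norm (y t) \<le> \<rho>"
  shows "W (y T) \<le> W (y 0) * exp (- \<eta> * T)"
proof -
  have der: "((\<lambda>t. W (y t) * exp (\<eta> * t)) has_derivative
      (\<lambda>h. h * ((W' (y t) (F (y t)) + \<eta> * W (y t)) * exp (\<eta> * t)))) (at t within {0..T})"
    if "0 \<le> t" "t \<le> T" for t
  proof -
    have "(y has_vector_derivative F (y t)) (at t within {0..T})"
      by (rule has_vector_derivative_within_subset[OF deriv[OF that(1)]]) auto
    then have "((W \<circ> y) has_vector_derivative W' (y t) (F (y t))) (at t within {0..T})"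
      by (rule vector_derivative_diff_chain_within) (use W' has_derivative_at_withinI in blast)
    then have "((\<lambda>t. W (y t)) has_real_derivative W' (y t) (F (y t))) (at t within {0..T})"
      by (simp add: o_def has_real_derivative_iff_has_vector_derivative)
    then have "((\<lambda>t. W (y t) * exp (\<eta> * t)) has_real_derivative
        (W' (y t) (F (y t)) + \<eta> * W (y t)) * exp (\<eta> * t)) (at t within {0..T})"
      by (auto intro!: derivative_eq_intros simp: algebra_simps)
    then show ?thesis
      by (simp add: has_field_derivative_def mult.commute[of _ "_ * exp _"])
  qed
  obtain t where t: "t \<in> {0..T}"
    and eq: "W (y T) * exp (\<eta> * T) - W (y 0) * exp (\<eta> * 0)
      = (T - 0) * ((W' (y t) (F (y t)) + \<eta> * W (y t)) * exp (\<eta> * t))"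
    using mvt_very_simple[OF T, of "\<lambda>t. W (y t) * exp (\<eta> * t)"
        "\<lambda>t h. h * ((W' (y t) (F (y t)) + \<eta> * W (y t)) * exp (\<eta> * t))"] der by auto
  have "W' (y t) (F (y t)) + \<eta> * W (y t) \<le> 0"
    using decay[OF inside, of t] t by auto
  then have "W (y T) * exp (\<eta> * T) \<le> W (y 0)"
    using eq T mult_nonneg_nonpos[of T "(W' (y t) (F (y t)) + \<eta> * W (y t)) * exp (\<eta> * t)"]
    by (simp add: mult_nonpos_nonneg)
  then show ?thesis by (simp add: exp_minus divide_simps)
qed

text \<open>The decay is known only inside the ball, so consider the first time \<open>s\<close> at
  which the norm reaches \<rho>. Up to \<open>s\<close> the decay applies, and
  \<open>W (y s)\<close> is at most \<open>W (y 0)\<close>, hence below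
  \<open>a * \<rho>\<^sup>2\<close>. But on and outside the sphere \<open>W\<close> is at least
  \<open>a * \<rho>\<^sup>2\<close>.\<close>

lemma lyapunov_invariant_ball:
  fixes y :: "real \<Rightarrow> 'a::real_normed_vector" and W :: "'a \<Rightarrow> real"
  assumes deriv: "\<And>t. t \<ge> 0 \<Longrightarrow> (y has_vector_derivative F (y t)) (at t within {0..})"
    and W': "\<And>x. (W has_derivative W' x) (at x)"
    and decay: "\<And>x. norm x \<le> \<rho> \<Longrightarrow> W' x (F x) \<le> - \<eta> * W x"
    and lower: "\<And>x. a * (norm x)\<^sup>2 \<le> W x"
    and pos: "a > 0" "\<rho> > 0" "\<eta> > 0"
    and init: "W (y 0) < a * \<rho>\<^sup>2" and T: "T \<ge> 0"
  shows "norm (y T) < \<rho>"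
proof (rule ccontr)
  assume "\<not> norm (y T) < \<rho>"
  define A where "A = {t \<in> {0..T}. \<rho> \<le> norm (y t)}"
  have "continuous_on {0..} y"
    by (rule continuous_on_vector_derivative[OF deriv]) simp
  then have cont: "continuous_on {0..T} y" by (rule continuous_on_subset) auto
  have "closed A" unfolding A_def
    by (intro continuous_on_closed_Collect_le continuous_intros cont)
  have "T \<in> A" using T \<open>\<not> norm (y T) < \<rho>\<close> by (simp add: A_def)
  have bdd: "bdd_below A" by (auto simp: A_def bdd_below_def)
  define s where "s = Inf A"
  have "s \<in> A" unfolding s_def
    using closed_contains_Inf[OF _ bdd \<open>closed A\<close>] \<open>T \<in> A\<close> by blast
  have lt: "norm (y t) < \<rho>" if "0 \<le> t" "t < s" for t
  proof (rule ccontr)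
    assume "\<not> norm (y t) < \<rho>"
    then have "t \<in> A" using that \<open>s \<in> A\<close> by (auto simp: A_def)
    then show False using cInf_lower[OF _ bdd] that by (force simp: s_def)
  qed
  have s0: "s \<noteq> 0"
  proof
    assume "s = 0"
    then have "\<rho> \<le> norm (y 0)" using \<open>s \<in> A\<close> by (simp add: A_def)
    then have "a * \<rho>\<^sup>2 \<le> a * (norm (y 0))\<^sup>2" using pos by (intro mult_left_mono power_mono) auto
    then show False using lower[of "y 0"] init by linarith
  qed
  then have "s > 0" using \<open>s \<in> A\<close> by (simp add: A_def)
  have "norm (y s) \<le> \<rho>"
  proof (rule tendsto_upperbound)
    show "\<not> trivial_limit (at s within {0..<s})"
      using \<open>s > 0\<close> by (simp add: trivial_limit_within islimpt_Ico)
    show "((\<lambda>t. norm (y t)) \<longlongrightarrow> norm (y s)) (at s within {0..<s})"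
    proof (rule tendsto_norm, rule tendsto_within_subset)
      show "(y \<longlongrightarrow> y s) (at s within {0..T})"
        using cont \<open>s \<in> A\<close> by (simp add: A_def continuous_on_def)
    qed (use \<open>s \<in> A\<close> in \<open>auto simp: A_def\<close>)
    show "\<forall>\<^sub>F t in at s within {0..<s}. norm (y t) \<le> \<rho>"
      using lt by (auto simp: eventually_at_filter less_imp_le)
  qed
  then have "norm (y t) \<le> \<rho>" if "0 \<le> t" "t \<le> s" for t
    using lt[of t] that by (cases "t = s") auto
  then have "W (y s) \<le> W (y 0) * exp (- \<eta> * s)"
    using \<open>s > 0\<close> by (intro lyapunov_exponential_decay[OF deriv W' decay]) auto
  also have "\<dots> \<le> W (y 0) * 1"
  proof (rule mult_left_mono)
    have "0 \<le> a * (norm (y 0))\<^sup>2" using pos by simp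
    then show "0 \<le> W (y 0)" using lower[of "y 0"] by linarith
  qed (use \<open>s > 0\<close> pos in simp)
  also have "\<dots> < a * \<rho>\<^sup>2" using init by simp
  also have "\<dots> \<le> a * (norm (y s))\<^sup>2"
    using pos \<open>s \<in> A\<close> by (intro mult_left_mono power_mono) (auto simp: A_def)
  finally show False using lower[of "y s"] by linarith
qed

text \<open>The sign condition on \<open>S x \<bullet> J x\<close> is the Lyapunov inequality for
  the linearisation \<open>J\<close>. Existence is a claim of its own; the last two claims concern
  every solution that starts close to 0.\<close>

lemma linearised_lyapunov_stability:
  fixes f J S :: "'a::euclidean_space \<Rightarrow> 'a"
  assumes f0: "f 0 = 0" and J: "(f has_derivative J) (at 0)"
    and lip: "K-lipschitz_on (cball 0 R) f" and R: "R > 0"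
    and S: "bounded_linear S" and sym: "\<And>x y. x \<bullet> S y = S x \<bullet> y"
    and pos: "\<And>x. x \<noteq> 0 \<Longrightarrow> 0 < x \<bullet> S x"
    and neg: "\<And>x. x \<noteq> 0 \<Longrightarrow> S x \<bullet> J x < 0"
    and \<epsilon>: "\<epsilon> > 0"
  obtains \<delta> where "\<delta> > 0"
    "\<And>y0. norm y0 < \<delta> \<Longrightarrow>
      \<exists>y. y 0 = y0 \<and> (\<forall>t\<ge>0. (y has_vector_derivative f (y t)) (at t within {0..}))"
    "\<And>y t. norm (y 0) < \<delta> \<Longrightarrow>
      (\<forall>t\<ge>0. (y has_vector_derivative f (y t)) (at t within {0..})) \<Longrightarrow> t \<ge> 0 \<Longrightarrow> norm (y t) < \<epsilon>"
    "\<And>y. norm (y 0) < \<delta> \<Longrightarrow>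
      (\<forall>t\<ge>0. (y has_vector_derivative f (y t)) (at t within {0..})) \<Longrightarrow> (y \<longlongrightarrow> 0) at_top"
proof -
  have blJ: "bounded_linear J" using J by (rule has_derivative_bounded_linear)
  define W where "W x = x \<bullet> S x" for x
  have "quadratic_form (\<lambda>x. x \<bullet> S x)"
    by (intro quadratic_form_inner bounded_linear_ident S)
  then obtain a where a: "a > 0" "\<And>x. a * (norm x)\<^sup>2 \<le> W x"
    unfolding W_def by (rule quadratic_form_pos_bound) (use pos in auto)
  have "quadratic_form (\<lambda>x. (-1) * (S x \<bullet> J x))"
    by (intro quadratic_form_cmult quadratic_form_inner blJ S)
  then obtain c where c: "c > 0" "\<And>x. c * (norm x)\<^sup>2 \<le> (-1) * (S x \<bullet> J x)"
    by (rule quadratic_form_pos_bound) (use neg in auto)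
  obtain C where C: "C > 0" "\<And>x. norm (S x) \<le> norm x * C"
    using bounded_linear.pos_bounded[OF S] by blast
  have upper: "W x \<le> C * (norm x)\<^sup>2" for x
  proof -
    have "W x \<le> norm x * norm (S x)" unfolding W_def by (rule norm_cauchy_schwarz)
    also have "\<dots> \<le> norm x * (norm x * C)" by (intro mult_left_mono C) auto
    finally show ?thesis by (simp add: power2_eq_square algebra_simps)
  qed
  have W': "(W has_derivative (\<lambda>h. 2 * (S x \<bullet> h))) (at x)" for x
  proof -
    have "(W has_derivative (\<lambda>h. x \<bullet> S h + h \<bullet> S x)) (at x)"
      unfolding W_def
      by (intro has_derivative_inner has_derivative_ident bounded_linear.has_derivative[OF S])
    moreover have "x \<bullet> S h + h \<bullet> S x = 2 * (S x \<bullet> h)" for h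
      using sym[of x h] by (simp add: inner_commute)
    ultimately show ?thesis by simp
  qed
  \<comment> \<open>Since \<open>norm (S x)\<close> is at most \<open>C * norm x\<close>, a
    remainder of relative size \<open>c / (2*C)\<close> changes \<open>S x \<bullet> f x\<close> by
    at most half of the decay \<open>c * (norm x)\<^sup>2\<close> of the linear part.\<close>
  obtain d where d: "d > 0" "\<And>x. norm x < d \<Longrightarrow> norm (f x - J x) \<le> c / (2*C) * norm x"
  proof -
    have "c / (2*C) > 0" using c C by simp
    then obtain d where "d > 0" "\<forall>x. norm (x - 0) < d \<longrightarrow>
        norm (f x - f 0 - J (x - 0)) \<le> c / (2*C) * norm (x - 0)"
      using J unfolding has_derivative_at_alt by blast
    then show ?thesis using f0 that by simp
  qed
  \<comment> \<open>The three bounds keep the ball strictly inside the region of small remainder,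
    inside the region where \<open>f\<close> is Lipschitz, and inside the target ball.\<close>
  define \<rho> where "\<rho> = min (d/2) (min R \<epsilon>)"
  have \<rho>: "\<rho> > 0" "\<rho> < d" "\<rho> \<le> R" "\<rho> \<le> \<epsilon>" using d R \<epsilon> by (auto simp: \<rho>_def)
  define \<eta> where "\<eta> = c / C"
  have \<eta>: "\<eta> > 0" using c C by (simp add: \<eta>_def)
  have decay: "2 * (S x \<bullet> f x) \<le> - \<eta> * W x" if "norm x \<le> \<rho>" for x
  proof -
    have "norm (S x) * norm (f x - J x) \<le> (norm x * C) * (c / (2*C) * norm x)"
      using that \<rho> C d(2)[of x] by (intro mult_mono) auto
    then have "S x \<bullet> (f x - J x) \<le> (norm x * C) * (c / (2*C) * norm x)"
      using norm_cauchy_schwarz[of "S x" "f x - J x"] by linarith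
    also have "\<dots> = c / 2 * (norm x)\<^sup>2" using C by (simp add: power2_eq_square field_simps)
    finally have "2 * (S x \<bullet> f x) \<le> - (c * (norm x)\<^sup>2)"
      using c(2)[of x] by (simp add: inner_diff_right)
    moreover have "\<eta> * W x \<le> \<eta> * (C * (norm x)\<^sup>2)"
      using \<eta> by (intro mult_left_mono upper) auto
    moreover have "\<eta> * (C * (norm x)\<^sup>2) = c * (norm x)\<^sup>2" using C by (simp add: \<eta>_def)
    ultimately show ?thesis by linarith
  qed
  \<comment> \<open>Chosen so that \<open>C * \<delta>\<^sup>2 = a * \<rho>\<^sup>2\<close>: the
    upper bound of \<open>W\<close> on the small ball meets its lower bound on the sphere of radius
    \<rho>.\<close>
  define \<delta> where "\<delta> = sqrt (a / C) * \<rho>"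
  have \<delta>: "\<delta> > 0" using a C \<rho> by (simp add: \<delta>_def)
  have init: "W y0 < a * \<rho>\<^sup>2" if "norm y0 < \<delta>" for y0
  proof -
    have "C * (norm y0)\<^sup>2 < C * \<delta>\<^sup>2"
      using that C by (intro mult_strict_left_mono power_strict_mono) auto
    also have "\<dots> = a * \<rho>\<^sup>2" using a C by (simp add: \<delta>_def power_mult_distrib)
    finally show ?thesis using upper[of y0] by linarith
  qed
  show ?thesis
  proof (rule that[OF \<delta>])
    fix y0 :: 'a
    assume y0: "norm y0 < \<delta>"
    \<comment> \<open>Projection to a closed convex set is nonexpansive and fixes the points of the
      set. So \<open>f\<close> after \<open>p\<close> is bounded and globally Lipschitz, and its
      solutions solve the original equation while they stay in the ball.\<close>
    define p where "p = closest_point (cball (0::'a) \<rho>)"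
    have p: "p x \<in> cball 0 \<rho>" for x
      unfolding p_def using \<rho> by (intro closest_point_in_set) auto
    have K: "K \<ge> 0" using lip lipschitz_on_nonneg by blast
    have flip: "norm (f x - f y) \<le> K * norm (x - y)" if "x \<in> cball 0 \<rho>" "y \<in> cball 0 \<rho>" for x y
      using lipschitz_on_normD[OF lip, of x y] that \<rho> by auto
    have "norm (f (p x) - f (p y)) \<le> (K + 1) * norm (x - y)" for x y
    proof -
      have "norm (f (p x) - f (p y)) \<le> K * norm (p x - p y)" by (intro flip p)
      also have "\<dots> \<le> (K + 1) * norm (x - y)"
        using closest_point_lipschitz[of "cball 0 \<rho>" x y] \<rho> K
        by (intro mult_mono) (auto simp: p_def dist_norm)
      finally show ?thesis .
    qed
    moreover have "norm (f (p x)) \<le> K * \<rho>" for x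
      using flip[OF p, of 0 x] p[of x] \<rho> K f0 mult_left_mono[of "norm (p x)" \<rho> K] by auto
    moreover have "K + 1 > 0" using K by simp
    ultimately obtain y where y: "y 0 = y0"
        "\<And>t. t \<ge> 0 \<Longrightarrow> (y has_vector_derivative f (p (y t))) (at t within {0..})"
      using lipschitz_ode_global_solution[of "\<lambda>x. f (p x)" "K + 1" "K * \<rho>" y0] by blast
    have pf: "p x = x" if "norm x \<le> \<rho>" for x
      unfolding p_def using that by (intro closest_point_self) auto
    have "norm (y t) < \<rho>" if "t \<ge> 0" for t
      by (rule lyapunov_invariant_ball[OF y(2) W' _ a(2) a(1) \<rho>(1) \<eta> _ that])
        (use init y0 y(1) decay pf in auto)
    then show "\<exists>y. y 0 = y0 \<and> (\<forall>t\<ge>0. (y has_vector_derivative f (y t)) (at t within {0..}))"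
      using y pf by (intro exI[of _ y]) (auto simp: less_imp_le)
  next
    fix y :: "real \<Rightarrow> 'a"
    assume y0: "norm (y 0) < \<delta>"
      and y: "\<forall>t\<ge>0. (y has_vector_derivative f (y t)) (at t within {0..})"
    have ball: "norm (y t) < \<rho>" if "t \<ge> 0" for t
      by (rule lyapunov_invariant_ball[OF _ W' decay a(2) a(1) \<rho>(1) \<eta> _ that])
        (use y init y0 in auto)
    show "norm (y t) < \<epsilon>" if "t \<ge> 0" for t
      using ball[OF that] \<rho> by linarith
    have bound: "(norm (y t))\<^sup>2 \<le> W (y 0) / a * exp (- \<eta> * t)" if "t \<ge> 0" for t
    proof -
      have "W (y t) \<le> W (y 0) * exp (- \<eta> * t)"
        by (rule lyapunov_exponential_decay[OF _ W' decay that])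
          (use y ball in \<open>auto simp: less_imp_le\<close>)
      then have "a * (norm (y t))\<^sup>2 \<le> W (y 0) * exp (- \<eta> * t)" using a(2)[of "y t"] by linarith
      then show ?thesis using a(1) by (simp add: field_simps)
    qed
    have "filterlim (\<lambda>t. - \<eta> * t) at_bot at_top"
      using \<eta> by (intro filterlim_tendsto_neg_mult_at_bot[OF tendsto_const] filterlim_ident) auto
    then have "((\<lambda>t. exp (- \<eta> * t)) \<longlongrightarrow> 0) at_top"
      by (rule filterlim_compose[OF exp_at_bot])
    then have lim: "((\<lambda>t. W (y 0) / a * exp (- \<eta> * t)) \<longlongrightarrow> 0) at_top"
      by (rule tendsto_mult_right_zero)
    have "((\<lambda>t. (norm (y t))\<^sup>2) \<longlongrightarrow> 0) at_top"
      by (rule tendsto_sandwich[OF _ _ tendsto_const lim])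
        (use bound in \<open>auto simp: eventually_at_top_linorder\<close>)
    then have "((\<lambda>t. sqrt ((norm (y t))\<^sup>2)) \<longlongrightarrow> sqrt 0) at_top"
      by (rule tendsto_real_sqrt)
    then show "(y \<longlongrightarrow> 0) at_top"
      by (simp add: tendsto_norm_zero_iff)
  qed
qed

section \<open>Coordinates of the state space\<close>

text \<open>A double sum depends only on the symmetric part of its summand. Identities between sums
  over lines thus reduce to one unordered pair of nodes, where the symmetry of susceptances and
  cosines and the antisymmetry of sines can be used.\<close>

lemma sum_sum_eq_symmetrized:
  fixes F H :: "'a::finite \<Rightarrow> 'a \<Rightarrow> real"
  assumes "\<And>i j. F i j + F j i = H i j + H j i"
  shows "(\<Sum>i\<in>UNIV. \<Sum>j\<in>UNIV. F i j) = (\<Sum>i\<in>UNIV. \<Sum>j\<in>UNIV. H i j)"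
proof -
  have *: "2 * (\<Sum>i\<in>UNIV. \<Sum>j\<in>UNIV. G i j) = (\<Sum>i\<in>UNIV. \<Sum>j\<in>UNIV. G i j + G j i)"
    for G :: "'a \<Rightarrow> 'a \<Rightarrow> real"
    using sum.swap[of G UNIV UNIV] by (simp add: sum.distrib)
  show ?thesis using *[of F] *[of H] assms by simp
qed

lemma sum_UNIV_option:
  "(\<Sum>i\<in>UNIV. F i) = F None + (\<Sum>k\<in>UNIV. F (Some k))"
  for F :: "'m::finite option \<Rightarrow> real"
  by (simp add: UNIV_option_conv sum.reindex)

lemma sum_UNIV_sum:
  "(\<Sum>a\<in>UNIV. F a)
    = (\<Sum>i\<in>UNIV. F (Inl i)) + (\<Sum>j\<in>UNIV. F (Inr j))"
  for F :: "'a::finite + 'b::finite \<Rightarrow> real"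
  unfolding UNIV_Plus_UNIV[symmetric] by (subst sum.Plus) auto

lemma state_vec_nth [simp]:
  "state_vec \<theta> \<omega> v $ Inl k = \<theta> (Some k)"
  "state_vec \<theta> \<omega> v $ Inr (Inl i) = \<omega> i"
  "state_vec \<theta> \<omega> v $ Inr (Inr i) = v i"
  by (simp_all add: state_vec_def)

lemma of_state_vec [simp]:
  "theta_of (state_vec \<theta> \<omega> v) (Some k) = \<theta> (Some k)"
  "theta_of x None = 0"
  "omega_of (state_vec \<theta> \<omega> v) i = \<omega> i"
  "volt_of (state_vec \<theta> \<omega> v) i = v i"
  by (simp_all add: theta_of_def omega_of_def volt_of_def)

lemma inner_state_vec:
  "state_vec \<theta> \<omega> v \<bullet> state_vec \<theta>' \<omega>' v'
    = (\<Sum>k\<in>UNIV. \<theta> (Some k) * \<theta>' (Some k)) + (\<Sum>i\<in>UNIV. \<omega> i * \<omega>' i) + (\<Sum>i\<in>UNIV. v i * v' i)"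
  by (simp add: inner_vec_def sum_UNIV_sum)

lemma state_vec_split: "x = state_vec (theta_of x) (omega_of x) (volt_of x)"
  by (vector state_vec_def) (simp add: theta_of_def omega_of_def volt_of_def split: sum.split)

text \<open>The angle sum may include the reference node because \<open>theta_of x None\<close> is
  0. So \<open>\<theta> None\<close>, which \<open>state_vec\<close> discards, can stay in sums over
  all pairs of nodes.\<close>

lemma inner_state:
  "x \<bullet> state_vec \<theta> \<omega> v
    = (\<Sum>i\<in>UNIV. theta_of x i * \<theta> i) + (\<Sum>i\<in>UNIV. omega_of x i * \<omega> i) + (\<Sum>i\<in>UNIV. volt_of x i * v i)"
  by (subst state_vec_split[of x]) (simp add: inner_state_vec sum_UNIV_option)

lemma bounded_linear_of_state [simp]:
  "bounded_linear (\<lambda>x. theta_of x i)" "bounded_linear (\<lambda>x. omega_of x j)" "bounded_linear (\<lambda>x. volt_of x k)"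
  unfolding theta_of_def omega_of_def volt_of_def
  by (cases i; simp add: bounded_linear_vec_nth bounded_linear_zero)+

lemma of_state_linear [simp]:
  "theta_of (x + y) i = theta_of x i + theta_of y i"
  "theta_of (c *\<^sub>R x) i = c * theta_of x i"
  "theta_of 0 i = 0"
  "omega_of (x + y) i = omega_of x i + omega_of y i"
  "omega_of (c *\<^sub>R x) i = c * omega_of x i"
  "omega_of 0 i = 0"
  "volt_of (x + y) i = volt_of x i + volt_of y i"
  "volt_of (c *\<^sub>R x) i = c * volt_of x i"
  "volt_of 0 i = 0"
  by (simp_all add: theta_of_def omega_of_def volt_of_def split: option.split)

lemmas of_state_derivative [derivative_intros] =
  bounded_linear_of_state[THEN bounded_linear.has_derivative]

lemma bounded_linear_state_vec:
  assumes "\<And>k. bounded_linear (\<lambda>x. \<theta> x (Some k))" "\<And>i. bounded_linear (\<lambda>x. \<omega> x i)"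
    "\<And>i. bounded_linear (\<lambda>x. v x i)"
  shows "bounded_linear (\<lambda>x. state_vec (\<theta> x) (\<omega> x) (v x))"
proof -
  have "bounded_linear (\<lambda>x. state_vec (\<theta> x) (\<omega> x) (v x) $ a)" for a
  proof (cases a)
    case (Inr c)
    then show ?thesis using assms by (cases c) auto
  qed (use assms in auto)
  then show ?thesis
    by (subst bounded_linear_componentwise_iff) (auto simp: Basis_vec_def inner_axis)
qed

lemma has_derivative_state_vec:
  assumes "\<And>k. ((\<lambda>x. \<theta> x (Some k)) has_derivative (\<lambda>h. \<theta>' h (Some k))) (at x)"
    and "\<And>i. ((\<lambda>x. \<omega> x i) has_derivative (\<lambda>h. \<omega>' h i)) (at x)"
    and "\<And>i. ((\<lambda>x. v x i) has_derivative (\<lambda>h. v' h i)) (at x)"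
  shows "((\<lambda>x. state_vec (\<theta> x) (\<omega> x) (v x)) has_derivative
      (\<lambda>h. state_vec (\<theta>' h) (\<omega>' h) (v' h))) (at x)"
proof -
  have "((\<lambda>x. state_vec (\<theta> x) (\<omega> x) (v x) $ a) has_derivative
      (\<lambda>h. state_vec (\<theta>' h) (\<omega>' h) (v' h) $ a)) (at x)" for a
  proof (cases a)
    case (Inr c)
    then show ?thesis using assms by (cases c) auto
  qed (use assms in auto)
  then show ?thesis
    by (subst has_derivative_componentwise_within) (auto simp: Basis_vec_def inner_axis)
qed

section \<open>Closure rules for Lipschitz functions, with existential constants so that they
  compose along the formula of the vector field\<close>

lemma lipschitz_real_mult:
  fixes f g :: "'a::metric_space \<Rightarrow> real"
  assumes "bounded X" "\<exists>K. K-lipschitz_on X f" "\<exists>K. K-lipschitz_on X g"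
  shows "\<exists>K. K-lipschitz_on X (\<lambda>x. f x * g x)"
proof -
  obtain K L where K: "K-lipschitz_on X f" and L: "L-lipschitz_on X g" using assms by blast
  show ?thesis
  proof (cases "X = {}")
    case False
    then obtain z where z: "z \<in> X" by blast
    have KL: "K \<ge> 0" "L \<ge> 0" using K L lipschitz_on_nonneg by blast+
    \<comment> \<open>On a bounded set a Lipschitz function is bounded by its value at one point
      plus its variation over the diameter.\<close>
    define A where "A = \<bar>f z\<bar> + K * diameter X"
    define B where "B = \<bar>g z\<bar> + L * diameter X"
    have A: "\<bar>f x\<bar> \<le> A" and B: "\<bar>g x\<bar> \<le> B" if "x \<in> X" for x
      using lipschitz_onD[OF K that z] lipschitz_onD[OF L that z] KL
        mult_left_mono[OF diameter_bounded_bound[OF assms(1) that z]]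
      by (force simp: A_def B_def dist_real_def)+
    have AB: "A \<ge> 0" "B \<ge> 0" using A[OF z] B[OF z] by linarith+
    have "(A * L + B * K)-lipschitz_on X (\<lambda>x. f x * g x)"
    proof (rule lipschitz_onI)
      fix x y assume xy: "x \<in> X" "y \<in> X"
      have "\<bar>f x * g x - f y * g y\<bar> = \<bar>f x * (g x - g y) + g y * (f x - f y)\<bar>"
        by (simp add: algebra_simps)
      also have "\<dots> \<le> \<bar>f x\<bar> * \<bar>g x - g y\<bar> + \<bar>g y\<bar> * \<bar>f x - f y\<bar>"
        by (metis abs_mult abs_triangle_ineq)
      also have "\<dots> \<le> A * (L * dist x y) + B * (K * dist x y)"
        using lipschitz_onD[OF K xy] lipschitz_onD[OF L xy] A B xy AB
        by (intro add_mono mult_mono) (auto simp: dist_real_def)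
      finally show "dist (f x * g x) (f y * g y) \<le> (A * L + B * K) * dist x y"
        by (simp add: dist_real_def algebra_simps)
    qed (use AB KL in simp)
    then show ?thesis ..
  qed (auto intro: exI[of _ 0])
qed

lemma lipschitz_bounded_linear:
  assumes "bounded_linear f"
  shows "\<exists>K. K-lipschitz_on X f"
proof -
  interpret bounded_linear f by fact
  obtain K where "K > 0" "\<And>x. norm (f x) \<le> norm x * K" using pos_bounded by blast
  then have "K-lipschitz_on X f"
    by (intro lipschitz_onI) (auto simp: dist_norm diff[symmetric] mult.commute)
  then show ?thesis ..
qed

lemma lipschitz_real_add:
  fixes f g :: "'a::metric_space \<Rightarrow> real"
  shows "\<exists>K. K-lipschitz_on X f \<Longrightarrow> \<exists>K. K-lipschitz_on X g \<Longrightarrow> \<exists>K. K-lipschitz_on X (\<lambda>x. f x + g x)"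
  using lipschitz_on_add by blast

lemma lipschitz_real_diff:
  fixes f g :: "'a::metric_space \<Rightarrow> real"
  shows "\<exists>K. K-lipschitz_on X f \<Longrightarrow> \<exists>K. K-lipschitz_on X g \<Longrightarrow> \<exists>K. K-lipschitz_on X (\<lambda>x. f x - g x)"
  using lipschitz_on_diff by blast

lemma lipschitz_const: "\<exists>K. K-lipschitz_on X (\<lambda>x. c)"
  using lipschitz_on_constant by blast

lemma lipschitz_real_sum:
  fixes f :: "'i \<Rightarrow> 'a::metric_space \<Rightarrow> real"
  assumes "\<And>i. i \<in> I \<Longrightarrow> \<exists>K. K-lipschitz_on X (f i)"
  shows "\<exists>K. K-lipschitz_on X (\<lambda>x. \<Sum>i\<in>I. f i x)"
  using assms
  by (induction I rule: infinite_finite_induct) (auto intro: lipschitz_const lipschitz_real_add)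

lemma lipschitz_real_compose:
  fixes f :: "'a::metric_space \<Rightarrow> real" and \<phi> :: "real \<Rightarrow> real"
  assumes \<phi>: "\<And>a b. \<bar>\<phi> a - \<phi> b\<bar> \<le> \<bar>a - b\<bar>" and "\<exists>K. K-lipschitz_on X f"
  shows "\<exists>K. K-lipschitz_on X (\<lambda>x. \<phi> (f x))"
proof -
  obtain K where K: "K-lipschitz_on X f" using assms by blast
  have "K-lipschitz_on X (\<lambda>x. \<phi> (f x))"
    using lipschitz_onD[OF K] lipschitz_on_nonneg[OF K] \<phi>
    by (intro lipschitz_onI) (auto simp: dist_real_def intro: order_trans[OF \<phi>])
  then show ?thesis ..
qed

lemma abs_sin_diff_le: "\<bar>sin a - sin b\<bar> \<le> \<bar>a - b\<bar>" for a b :: real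
proof -
  have "norm (sin a - sin b) \<le> 1 * norm (a - b)"
    by (rule field_differentiable_bound[of UNIV sin cos])
      (auto intro: DERIV_sin has_field_derivative_at_within)
  then show ?thesis by simp
qed

lemma abs_cos_diff_le: "\<bar>cos a - cos b\<bar> \<le> \<bar>a - b\<bar>" for a b :: real
  using abs_sin_diff_le[of "a + pi/2" "b + pi/2"] by (simp add: sin_add)

lemma lipschitz_componentwise:
  fixes f :: "'a::metric_space \<Rightarrow> real^'n"
  assumes "\<And>a. \<exists>K. K-lipschitz_on X (\<lambda>x. f x $ a)"
  shows "\<exists>K. K-lipschitz_on X f"
proof -
  obtain K where K: "\<And>a. (K a)-lipschitz_on X (\<lambda>x. f x $ a)" using assms by metis
  have "(\<Sum>a\<in>UNIV. K a)-lipschitz_on X f"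
  proof (rule lipschitz_onI)
    fix x y assume xy: "x \<in> X" "y \<in> X"
    have "norm (f x - f y) \<le> (\<Sum>a\<in>UNIV. \<bar>(f x - f y) $ a\<bar>)" by (rule norm_le_l1_cart)
    also have "\<dots> \<le> (\<Sum>a\<in>UNIV. K a * dist x y)"
      using lipschitz_onD[OF K xy] by (intro sum_mono) (simp add: dist_real_def)
    finally show "dist (f x) (f y) \<le> (\<Sum>a\<in>UNIV. K a) * dist x y"
      by (simp add: dist_norm sum_distrib_right)
  qed (auto intro: sum_nonneg lipschitz_on_nonneg K)
  then show ?thesis ..
qed

section \<open>The power grid\<close>

text \<open>The balance equations are stated with sums over all nodes. They agree with the sums over
  neighbours because susceptances vanish off the edges and conductances vanish everywhere, and they
  make every double sum range over a square, so that indices can be exchanged.\<close>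

locale power_grid =
  fixes N :: "'m::finite option power_network" and \<theta>s vs :: "'m option \<Rightarrow> real"
  assumes suscept_sym: "suscept N i j = suscept N j i"
    and suscept_no_edge: "(i, j) \<notin> edges N \<Longrightarrow> suscept N i j = 0"
    and tree: "hierarchical_tree N"
    and lossless: "conduct N i j = 0"
    and inertia_pos: "inertia N i > 0" and damping_pos: "damping N i > 0"
    and volt_time_pos: "volt_time N i > 0" and vs_pos: "vs i > 0"
    and sync_P: "(\<Sum>j\<in>UNIV. flowP N \<theta>s vs i j) = netP N i"
    and sync_Q: "(\<Sum>j\<in>UNIV. flowQ N \<theta>s vs i j) = netQ N i - volt_droop N i * vs i"
begin

abbreviation "b \<equiv> suscept N"

abbreviation "ang x i \<equiv> \<theta>s i + theta_of x i"

abbreviation "vlt x i \<equiv> vs i + volt_of x i"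

text \<open>The angle derivative of the potential, at \<open>None\<close> too: the reference angle
  is no coordinate of the state, but this force still acts on the reference frequency.\<close>

definition grad_theta :: "'m state \<Rightarrow> 'm option \<Rightarrow> real" where
  "grad_theta x i = - netP N i + (\<Sum>j\<in>UNIV. b i j * vlt x i * vlt x j * sin (ang x i - ang x j))"

definition grad_volt :: "'m state \<Rightarrow> 'm option \<Rightarrow> real" where
  "grad_volt x i = volt_droop N i - netQ N i / vlt x i - (\<Sum>j\<in>UNIV. b i j * vlt x j * cos (ang x i - ang x j))"

definition grad :: "'m state \<Rightarrow> 'm state" where
  "grad x = state_vec (grad_theta x) (\<lambda>i. inertia N i * omega_of x i) (grad_volt x)"

definition hess_theta :: "'m state \<Rightarrow> 'm option \<Rightarrow> real" where
  "hess_theta y i = (\<Sum>j\<in>UNIV. b i j *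
     ((volt_of y i * vs j + vs i * volt_of y j) * sin (\<theta>s i - \<theta>s j)
      + vs i * vs j * cos (\<theta>s i - \<theta>s j) * (theta_of y i - theta_of y j)))"

definition hess_volt :: "'m state \<Rightarrow> 'm option \<Rightarrow> real" where
  "hess_volt y i = netQ N i / (vs i)\<^sup>2 * volt_of y i
     - (\<Sum>j\<in>UNIV. b i j * (volt_of y j * cos (\<theta>s i - \<theta>s j)
          - vs j * sin (\<theta>s i - \<theta>s j) * (theta_of y i - theta_of y j)))"

definition hess :: "'m state \<Rightarrow> 'm state" where
  "hess y = state_vec (hess_theta y) (\<lambda>i. inertia N i * omega_of y i) (hess_volt y)"

lemma sin_swap: "sin (\<alpha> j - \<alpha> i) = - sin (\<alpha> i - \<alpha> j)" for \<alpha> :: "'m option \<Rightarrow> real"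
  by (metis minus_diff_eq sin_minus)

lemma cos_swap: "cos (\<alpha> j - \<alpha> i) = cos (\<alpha> i - \<alpha> j)" for \<alpha> :: "'m option \<Rightarrow> real"
  by (metis minus_diff_eq cos_minus)

lemma nbrs_high_iff:
  assumes "(i, j) \<in> edges N"
  shows "j \<in> nbrs_high N i \<longleftrightarrow> i \<notin> nbrs_high N j"
proof -
  have "(j, i) \<in> edges N" using assms tree by (auto simp: hierarchical_tree_def dest: symD)
  moreover have "edges N \<subseteq> L5 N \<times> L4 N \<union> L4 N \<times> L5 N \<union> L4 N \<times> L3 N \<union> L3 N \<times> L4 N"
    "L5 N \<inter> L4 N = {}" "L5 N \<inter> L3 N = {}" "L4 N \<inter> L3 N = {}"
    using tree by (auto simp: hierarchical_tree_def)
  ultimately show ?thesis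
    using assms unfolding nbrs_high_def nbrs_def by blast
qed

text \<open>\<open>potential\<close> counts each line once, at its lower end. Disjointness of the
  levels makes exactly one end the lower one, so half the sum over ordered pairs has the same value,
  and this form can be symmetrised.\<close>

lemma potential_eq:
  "potential N \<theta> v = (\<Sum>i\<in>UNIV. - netP N i * \<theta> i + volt_droop N i * v i - netQ N i * ln (v i))
     - (\<Sum>i\<in>UNIV. \<Sum>j\<in>UNIV. b i j * v i * v j * cos (\<theta> i - \<theta> j) / 2)"
proof -
  define X where "X i j = b i j * v i * v j * cos (\<theta> i - \<theta> j)" for i j
  have X: "X j i = X i j" for i j
    by (simp add: X_def suscept_sym[of j i] cos_swap[of \<theta> j i])
  have "(\<Sum>i\<in>UNIV. \<Sum>j\<in>UNIV. if j \<in> nbrs_high N i then X i j else 0)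
      = (\<Sum>i\<in>UNIV. \<Sum>j\<in>UNIV. X i j / 2)"
  proof (rule sum_sum_eq_symmetrized)
    fix i j
    show "(if j \<in> nbrs_high N i then X i j else 0) + (if i \<in> nbrs_high N j then X j i else 0)
        = X i j / 2 + X j i / 2"
    proof (cases "(i, j) \<in> edges N")
      case False
      then have "X i j = 0" by (simp add: X_def suscept_no_edge)
      then show ?thesis using X by simp
    qed (use X nbrs_high_iff in auto)
  qed
  moreover have "(\<Sum>j\<in>nbrs_high N i. X i j) = (\<Sum>j\<in>UNIV. if j \<in> nbrs_high N i then X i j else 0)" for i
    by (simp add: sum.If_cases)
  ultimately show ?thesis
    unfolding potential_def X_def by (simp add: sum_subtractf)
qed

lemma energy_directional_derivative:
  assumes pos: "\<And>i. vlt x i > 0"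
  shows "((\<lambda>h. energy N \<theta>s vs (x + h *\<^sub>R y)) has_real_derivative y \<bullet> grad x) (at 0)"
proof -
  let ?c = "\<lambda>i j. cos (ang x i - ang x j)" and ?s = "\<lambda>i j. sin (ang x i - ang x j)"
  let ?F = "\<lambda>i j. b i j * ((volt_of y i * vlt x j + vlt x i * volt_of y j) * ?c i j
      - vlt x i * vlt x j * ?s i j * (theta_of y i - theta_of y j)) / 2"
  have kin: "((\<lambda>h. \<Sum>i\<in>UNIV. 1/2 * inertia N i * (omega_of (x + h *\<^sub>R y) i)\<^sup>2) has_real_derivative
      (\<Sum>i\<in>UNIV. omega_of y i * (inertia N i * omega_of x i))) (at 0)"
    by (auto intro!: derivative_eq_intros sum.cong simp: field_simps)
  have diag: "((\<lambda>h. \<Sum>i\<in>UNIV. - netP N i * ang (x + h *\<^sub>R y) i + volt_droop N i * vlt (x + h *\<^sub>R y) i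
       - netQ N i * ln (vlt (x + h *\<^sub>R y) i)) has_real_derivative
      (\<Sum>i\<in>UNIV. - netP N i * theta_of y i + volt_droop N i * volt_of y i
        - netQ N i * (volt_of y i / vlt x i))) (at 0)"
    using pos by (auto intro!: derivative_eq_intros sum.cong simp: field_simps)
  have coup: "((\<lambda>h. \<Sum>i\<in>UNIV. \<Sum>j\<in>UNIV. b i j * vlt (x + h *\<^sub>R y) i * vlt (x + h *\<^sub>R y) j
         * cos (ang (x + h *\<^sub>R y) i - ang (x + h *\<^sub>R y) j) / 2) has_real_derivative
      (\<Sum>i\<in>UNIV. \<Sum>j\<in>UNIV. ?F i j)) (at 0)"
    by (intro DERIV_sum) (auto intro!: derivative_eq_intros simp: algebra_simps diff_divide_distrib add_divide_distrib)
  have "((\<lambda>h. energy N \<theta>s vs (x + h *\<^sub>R y)) has_real_derivative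
      (\<Sum>i\<in>UNIV. omega_of y i * (inertia N i * omega_of x i))
      + ((\<Sum>i\<in>UNIV. - netP N i * theta_of y i + volt_droop N i * volt_of y i
        - netQ N i * (volt_of y i / vlt x i)) - (\<Sum>i\<in>UNIV. \<Sum>j\<in>UNIV. ?F i j)) - 0) (at 0)"
    unfolding energy_def potential_eq
    by (intro DERIV_diff DERIV_add DERIV_const kin diag coup)
  \<comment> \<open>The product rule spreads each derivative over both ends of a line.
    Symmetrisation collects at node \<open>i\<close> everything that multiplies its own angle or
    voltage direction, which also removes the factor 1/2.\<close>
  moreover have "(\<Sum>i\<in>UNIV. \<Sum>j\<in>UNIV. ?F i j) = (\<Sum>i\<in>UNIV. \<Sum>j\<in>UNIV.
      b i j * (volt_of y i * vlt x j * ?c i j - theta_of y i * vlt x i * vlt x j * ?s i j))"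
  proof (rule sum_sum_eq_symmetrized)
    fix i j
    show "?F i j + ?F j i = b i j * (volt_of y i * vlt x j * ?c i j - theta_of y i * vlt x i * vlt x j * ?s i j)
        + b j i * (volt_of y j * vlt x i * ?c j i - theta_of y j * vlt x j * vlt x i * ?s j i)"
      unfolding suscept_sym[of j i] sin_swap[of "ang x" j i] cos_swap[of "ang x" j i]
      by (simp add: field_simps)
  qed
  moreover have "(\<Sum>i\<in>UNIV. \<Sum>j\<in>UNIV.
      b i j * (volt_of y i * vlt x j * ?c i j - theta_of y i * vlt x i * vlt x j * ?s i j))
    = (\<Sum>i\<in>UNIV. volt_of y i * (\<Sum>j\<in>UNIV. b i j * vlt x j * ?c i j)
        - theta_of y i * (\<Sum>j\<in>UNIV. b i j * vlt x i * vlt x j * ?s i j))"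
    unfolding sum_distrib_left sum_subtractf[symmetric]
    by (intro sum.cong refl) (simp add: algebra_simps)
  moreover have "y \<bullet> grad x = (\<Sum>i\<in>UNIV. omega_of y i * (inertia N i * omega_of x i))
      + ((\<Sum>i\<in>UNIV. - netP N i * theta_of y i + volt_droop N i * volt_of y i
          - netQ N i * (volt_of y i / vlt x i))
        - (\<Sum>i\<in>UNIV. volt_of y i * (\<Sum>j\<in>UNIV. b i j * vlt x j * ?c i j)
          - theta_of y i * (\<Sum>j\<in>UNIV. b i j * vlt x i * vlt x j * ?s i j))) - 0"
    unfolding grad_def inner_state grad_theta_def grad_volt_def sum.distrib[symmetric]
      sum_subtractf[symmetric] diff_0_right
    by (intro sum.cong refl) (simp add: distrib_left right_diff_distrib)
  ultimately show ?thesis by simp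
qed

lemma hess_theta_derivative:
  "((\<lambda>x. grad_theta x i) has_derivative (\<lambda>y. hess_theta y i)) (at 0)"
  unfolding grad_theta_def hess_theta_def
  by (auto intro!: derivative_eq_intros sum.cong simp: algebra_simps)

lemma hess_volt_derivative:
  "((\<lambda>x. grad_volt x i) has_derivative (\<lambda>y. hess_volt y i)) (at 0)"
  unfolding grad_volt_def hess_volt_def
  using vs_pos[of i]
  by (auto intro!: derivative_eq_intros sum.cong simp: field_simps power2_eq_square)

lemma bounded_linear_hess_theta: "bounded_linear (\<lambda>y. hess_theta y i)"
  using hess_theta_derivative by (rule has_derivative_bounded_linear)

lemma bounded_linear_hess_volt: "bounded_linear (\<lambda>y. hess_volt y i)"
  using hess_volt_derivative by (rule has_derivative_bounded_linear)

lemma hess_derivative: "(grad has_derivative hess) (at 0)"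
  unfolding grad_def[abs_def] hess_def[abs_def]
  by (intro has_derivative_state_vec hess_theta_derivative hess_volt_derivative
      has_derivative_mult_right of_state_derivative has_derivative_ident)

text \<open>Read off the explicit coupling terms: the contributions of a pair of nodes in both
  orders add up to an expression symmetric in \<open>y\<close> and \<open>z\<close>.\<close>

lemma hess_symmetric: "z \<bullet> hess y = y \<bullet> hess z"
proof -
  let ?c = "\<lambda>i j. cos (\<theta>s i - \<theta>s j)" and ?s = "\<lambda>i j. sin (\<theta>s i - \<theta>s j)"
  let ?F = "\<lambda>z y i j. b i j * (theta_of z i * ((volt_of y i * vs j + vs i * volt_of y j) * ?s i j
      + vs i * vs j * ?c i j * (theta_of y i - theta_of y j))
      - volt_of z i * (volt_of y j * ?c i j - vs j * ?s i j * (theta_of y i - theta_of y j)))"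
  have eq: "z \<bullet> hess y = (\<Sum>i\<in>UNIV. inertia N i * omega_of z i * omega_of y i
      + netQ N i / (vs i)\<^sup>2 * volt_of z i * volt_of y i) + (\<Sum>i\<in>UNIV. \<Sum>j\<in>UNIV. ?F z y i j)" for z y
  proof -
    have "(\<Sum>i\<in>UNIV. \<Sum>j\<in>UNIV. ?F z y i j) = (\<Sum>i\<in>UNIV. theta_of z i * hess_theta y i
        + volt_of z i * (hess_volt y i - netQ N i / (vs i)\<^sup>2 * volt_of y i))"
      unfolding hess_theta_def hess_volt_def
      by (simp add: sum_distrib_left sum_subtractf[symmetric] right_diff_distrib algebra_simps del: sum_subtractf)
    then show ?thesis
      by (simp add: hess_def inner_state sum.distrib sum_subtractf algebra_simps)
  qed
  have "(\<Sum>i\<in>UNIV. \<Sum>j\<in>UNIV. ?F z y i j) = (\<Sum>i\<in>UNIV. \<Sum>j\<in>UNIV. ?F y z i j)"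
  proof (rule sum_sum_eq_symmetrized)
    fix i j
    show "?F z y i j + ?F z y j i = ?F y z i j + ?F y z j i"
      unfolding suscept_sym[of j i] sin_swap[of \<theta>s j i] cos_swap[of \<theta>s j i]
      by (simp add: algebra_simps)
  qed
  then show ?thesis unfolding eq by (simp add: mult.commute mult.left_commute)
qed

lemma eventually_volt_pos: "\<forall>\<^sub>F x in nhds 0. \<forall>i. vlt x i > 0"
proof -
  have "\<forall>\<^sub>F x in nhds 0. vlt x i > 0" for i
  proof -
    have "continuous_on UNIV (\<lambda>x::'m state. vlt x i)"
      by (intro continuous_on_add continuous_on_const linear_continuous_on bounded_linear_of_state)
    then have "open {x::'m state. 0 < vlt x i}" by (intro open_Collect_less continuous_on_const)
    then show ?thesis
      using vs_pos eventually_nhds_in_open[of "{x::'m state. 0 < vlt x i}" 0] by simp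
  qed
  then show ?thesis by (simp add: eventually_all_finite)
qed

lemma partial_deriv_energy:
  assumes "\<And>i. vlt x i > 0"
  shows "partial_deriv a (energy N \<theta>s vs) x = grad x $ a"
  unfolding partial_deriv_def
  using DERIV_imp_deriv[OF energy_directional_derivative[OF assms, of "axis a 1"]]
  by (simp add: inner_axis')

text \<open>\<open>hessian\<close> iterates \<open>deriv\<close>, so the inner partial derivative
  has to agree with \<open>grad\<close> on a whole neighbourhood before the outer one is taken.
  Positivity of the voltages near the equilibrium provides this, since the energy contains their
  logarithms.\<close>

lemma hessian_energy_nth: "hessian (energy N \<theta>s vs) 0 $ a $ c = hess (axis a 1) $ c"
proof -
  have line: "((\<lambda>h::real. h *\<^sub>R axis a 1) has_derivative (\<lambda>h. h *\<^sub>R axis a (1::real))) (at 0)"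
    by (intro derivative_intros)
  have "(grad has_derivative hess) (at (0 *\<^sub>R axis a (1::real)))" using hess_derivative by simp
  from diff_chain_at[OF line this]
  have "((\<lambda>h. grad (h *\<^sub>R axis a 1)) has_derivative (\<lambda>h. hess (h *\<^sub>R axis a 1))) (at 0)"
    by (simp add: o_def)
  then have "((\<lambda>h. grad (h *\<^sub>R axis a 1) $ c) has_derivative (\<lambda>h. hess (h *\<^sub>R axis a 1) $ c)) (at 0)"
    by (rule bounded_linear.has_derivative[OF bounded_linear_vec_nth])
  moreover have "hess (h *\<^sub>R axis a 1) = h *\<^sub>R hess (axis a 1)" for h
    using hess_derivative has_derivative_bounded_linear bounded_linear.linear linear_cmul by blast
  ultimately have der: "((\<lambda>h. grad (h *\<^sub>R axis a 1) $ c) has_real_derivative hess (axis a 1) $ c) (at 0)"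
    by (simp add: has_field_derivative_def mult_commute_abs)
  have "((\<lambda>h::real. h *\<^sub>R axis a 1) \<longlongrightarrow> 0 *\<^sub>R axis a (1::real)) (nhds 0)"
    by (intro tendsto_intros filterlim_ident)
  then have "filterlim (\<lambda>h::real. h *\<^sub>R axis a (1::real)) (nhds 0) (nhds 0)" by simp
  then have "\<forall>\<^sub>F h in nhds 0. \<forall>i. vlt (h *\<^sub>R axis a 1) i > 0"
    using eventually_volt_pos unfolding filterlim_iff by blast
  then have "\<forall>\<^sub>F h in nhds 0. partial_deriv c (energy N \<theta>s vs) (h *\<^sub>R axis a 1) = grad (h *\<^sub>R axis a 1) $ c"
    by (rule eventually_mono) (use partial_deriv_energy in blast)
  then have "((\<lambda>h. partial_deriv c (energy N \<theta>s vs) (h *\<^sub>R axis a 1)) has_real_derivative hess (axis a 1) $ c) (at 0)"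
    using der by (subst DERIV_cong_ev[OF refl _ refl])
  then show ?thesis
    using DERIV_imp_deriv
    by (fastforce simp: hessian_def partial_deriv_def[of a "partial_deriv c (energy N \<theta>s vs)"])
qed

lemma hessian_energy_mult: "hessian (energy N \<theta>s vs) 0 *v y = hess y"
proof -
  have "(hessian (energy N \<theta>s vs) 0 *v y) $ a = hess y $ a" for a
  proof -
    have "(hessian (energy N \<theta>s vs) 0 *v y) $ a = y \<bullet> hess (axis a 1)"
      by (simp add: matrix_vector_mult_def hessian_energy_nth inner_vec_def mult.commute)
    also have "\<dots> = hess y $ a"
      by (subst hess_symmetric) (simp add: inner_axis')
    finally show ?thesis .
  qed
  then show ?thesis by (simp add: vec_eq_iff)
qed

section \<open>The vector field, its gradient structure and its linearisation\<close>

lemma vector_field_eq: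
  "vector_field N \<theta>s vs x = state_vec (omega_of x)
     (\<lambda>i. (- damping N i * omega_of x i - grad_theta x i) / inertia N i)
     (\<lambda>i. (- volt_droop N i * vlt x i + netQ N i
       + (\<Sum>j\<in>UNIV. b i j * vlt x i * vlt x j * cos (ang x i - ang x j))) / volt_time N i)"
  unfolding vector_field_def Let_def
proof (rule arg_cong2[where f="state_vec (omega_of x)"])
  show "(\<lambda>i. (- damping N i * omega_of x i + netP N i
        - (\<Sum>j\<in>UNIV. flowP N (ang x) (vlt x) i j)) / inertia N i)
      = (\<lambda>i. (- damping N i * omega_of x i - grad_theta x i) / inertia N i)"
    by (simp add: grad_theta_def flowP_def lossless algebra_simps)
  show "(\<lambda>i. (- volt_droop N i * vlt x i + netQ N i
        - (\<Sum>j\<in>UNIV. flowQ N (ang x) (vlt x) i j)) / volt_time N i)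
      = (\<lambda>i. (- volt_droop N i * vlt x i + netQ N i
       + (\<Sum>j\<in>UNIV. b i j * vlt x i * vlt x j * cos (ang x i - ang x j))) / volt_time N i)"
    by (simp add: flowQ_def lossless sum_negf mult_ac)
qed

lemma grad_theta_0: "grad_theta 0 i = 0"
  using sync_P[of i] by (simp add: grad_theta_def flowP_def lossless algebra_simps)

text \<open>Multiplication by the voltage clears the quotient in \<open>grad_volt\<close>. The
  voltages thus follow a gradient flow whose rate \<open>vlt x i / volt_time N i\<close> depends on
  the state.\<close>

lemma volt_rate_eq:
  assumes "vlt x i \<noteq> 0"
  shows "(- volt_droop N i * vlt x i + netQ N i
       + (\<Sum>j\<in>UNIV. b i j * vlt x i * vlt x j * cos (ang x i - ang x j))) / volt_time N i
    = - (vlt x i / volt_time N i) * grad_volt x i"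
proof -
  have "vlt x i * grad_volt x i = volt_droop N i * vlt x i - netQ N i
      - (\<Sum>j\<in>UNIV. b i j * vlt x i * vlt x j * cos (ang x i - ang x j))"
    using assms unfolding grad_volt_def right_diff_distrib sum_distrib_left
    by (simp add: mult_ac)
  then have "- volt_droop N i * vlt x i + netQ N i
       + (\<Sum>j\<in>UNIV. b i j * vlt x i * vlt x j * cos (ang x i - ang x j)) = - (vlt x i * grad_volt x i)"
    by linarith
  then show ?thesis by simp
qed

lemma grad_volt_0: "grad_volt 0 i = 0"
proof -
  have "- volt_droop N i * vs i + netQ N i
       + (\<Sum>j\<in>UNIV. b i j * vs i * vs j * cos (\<theta>s i - \<theta>s j)) = 0"
    using sync_Q[of i] by (simp add: flowQ_def lossless sum_negf algebra_simps)
  then have "- (vs i / volt_time N i) * grad_volt 0 i = 0"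
    using volt_rate_eq[where x=0 and i=i] vs_pos[of i] by simp
  then show ?thesis using vs_pos[of i] volt_time_pos[of i] by simp
qed

lemma vector_field_0: "vector_field N \<theta>s vs 0 = 0"
proof -
  have "vector_field N \<theta>s vs 0 $ a = 0" for a
  proof (cases a)
    case (Inr c)
    then show ?thesis
    proof (cases c)
      case i: (Inr i)
      then show ?thesis
        using volt_rate_eq[where x=0 and i=i] vs_pos[of i] \<open>a = Inr c\<close>
        by (simp add: vector_field_eq grad_volt_0)
    qed (simp add: vector_field_eq grad_theta_0)
  qed (simp add: vector_field_eq)
  then show ?thesis by (simp add: vec_eq_iff)
qed

definition jac :: "'m state \<Rightarrow> 'm state" where
  "jac y = state_vec (omega_of y)
     (\<lambda>i. (- damping N i * omega_of y i - hess_theta y i) / inertia N i)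
     (\<lambda>i. - (vs i / volt_time N i) * hess_volt y i)"

lemma vector_field_derivative: "(vector_field N \<theta>s vs has_derivative jac) (at 0)"
  unfolding vector_field_eq[abs_def] jac_def[abs_def]
proof (rule has_derivative_state_vec)
  show "((\<lambda>x. omega_of x (Some k)) has_derivative (\<lambda>h. omega_of h (Some k))) (at 0)" for k
    by (auto intro!: derivative_eq_intros)
  show "((\<lambda>x. (- damping N i * omega_of x i - grad_theta x i) / inertia N i) has_derivative
      (\<lambda>h. (- damping N i * omega_of h i - hess_theta h i) / inertia N i)) (at 0)" for i
    by (intro bounded_linear.has_derivative[OF bounded_linear_divide] has_derivative_diff
        hess_theta_derivative has_derivative_mult_right of_state_derivative has_derivative_ident)
  show "((\<lambda>x. (- volt_droop N i * vlt x i + netQ N i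
       + (\<Sum>j\<in>UNIV. b i j * vlt x i * vlt x j * cos (ang x i - ang x j))) / volt_time N i)
     has_derivative (\<lambda>h. - (vs i / volt_time N i) * hess_volt h i)) (at 0)" for i
  proof (rule has_derivative_transform_eventually)
    have "((\<lambda>x. - (vlt x i / volt_time N i)) has_derivative (\<lambda>h. - (volt_of h i / volt_time N i))) (at 0)"
      using volt_time_pos[of i] by (auto intro!: derivative_eq_intros)
    \<comment> \<open>The derivative of the state-dependent rate drops out because it is multiplied
      by \<open>grad_volt 0 i\<close>, which is 0; only the rate at the equilibrium remains in
      \<open>jac\<close>.\<close>
    from has_derivative_mult[OF this hess_volt_derivative[of i]]
    show "((\<lambda>x. - (vlt x i / volt_time N i) * grad_volt x i) has_derivative
        (\<lambda>h. - (vs i / volt_time N i) * hess_volt h i)) (at 0)"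
      by (simp add: grad_volt_0)
    have "\<forall>\<^sub>F x in at 0. \<forall>i. vlt x i > 0"
      using eventually_volt_pos by (simp add: eventually_nhds_conv_at)
    then show "\<forall>\<^sub>F x in at 0. - (vlt x i / volt_time N i) * grad_volt x i
      = (- volt_droop N i * vlt x i + netQ N i
       + (\<Sum>j\<in>UNIV. b i j * vlt x i * vlt x j * cos (ang x i - ang x j))) / volt_time N i"
    proof (rule eventually_mono)
      fix x :: "'m state"
      assume "\<forall>i. vlt x i > 0"
      then have "vlt x i \<noteq> 0" by (metis less_irrefl)
      then show "- (vlt x i / volt_time N i) * grad_volt x i
        = (- volt_droop N i * vlt x i + netQ N i
         + (\<Sum>j\<in>UNIV. b i j * vlt x i * vlt x j * cos (ang x i - ang x j))) / volt_time N i"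
        by (rule volt_rate_eq[symmetric])
    qed
    show "- (vlt 0 i / volt_time N i) * grad_volt 0 i
      = (- volt_droop N i * vlt 0 i + netQ N i
       + (\<Sum>j\<in>UNIV. b i j * vlt 0 i * vlt 0 j * cos (ang 0 i - ang 0 j))) / volt_time N i"
      using volt_rate_eq[where x=0 and i=i] vs_pos[of i] by simp
  qed simp
qed

text \<open>The voltage component is used in its form without \<open>grad_volt\<close>, hence
  polynomial in the voltages. Divisors are parameters only, so the bounded set may contain states
  with zero or negative voltages.\<close>

lemma vector_field_lipschitz:
  assumes "bounded X"
  shows "\<exists>K. K-lipschitz_on X (vector_field N \<theta>s vs)"
proof (rule lipschitz_componentwise)
  fix a
  note lin = lipschitz_bounded_linear[OF bounded_linear_of_state(1)]
    lipschitz_bounded_linear[OF bounded_linear_of_state(2)]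
    lipschitz_bounded_linear[OF bounded_linear_of_state(3)]
  note rules = lipschitz_real_sum lipschitz_real_add lipschitz_real_diff lipschitz_real_mult[OF assms]
    lipschitz_const lipschitz_real_compose[of sin, OF abs_sin_diff_le]
    lipschitz_real_compose[of cos, OF abs_cos_diff_le] lin
  show "\<exists>K. K-lipschitz_on X (\<lambda>x. vector_field N \<theta>s vs x $ a)"
  proof (cases a)
    case (Inl k)
    then show ?thesis by (simp add: vector_field_eq lin)
  next
    case (Inr c)
    show ?thesis
    proof (cases c)
      case (Inl i)
      show ?thesis
        unfolding \<open>a = Inr c\<close> Inl vector_field_eq state_vec_nth grad_theta_def divide_inverse
        by (intro rules)
    next
      case (Inr i)
      show ?thesis
        unfolding \<open>a = Inr c\<close> Inr vector_field_eq state_vec_nth divide_inverse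
        by (intro rules)
    qed
  qed
qed

text \<open>The reference angle is frozen, but its frequency is not, so the energy is not monotone along
  solutions: the term \<open>- \<omega> None * grad_theta x None\<close> has no sign. Since no other coordinate depends
  on \<open>\<omega> None\<close>, it suffices to give the kinetic energy of the reference node a small weight \<open>\<kappa>\<close>. The
  cross term with weight \<open>\<beta>\<close> makes the decay strict in the angles as well.\<close>

definition lyap :: "real \<Rightarrow> real \<Rightarrow> 'm state \<Rightarrow> 'm state" where
  "lyap \<beta> \<kappa> x = state_vec
     (\<lambda>i. hess_theta x i + \<beta> * (inertia N i * omega_of x i))
     (\<lambda>i. inertia N i * (case i of None \<Rightarrow> \<kappa> * omega_of x i | Some k \<Rightarrow> omega_of x i + \<beta> * theta_of x i))
     (hess_volt x)"

text \<open>The dissipation and the cross term do not see the reference frequency, so their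
  definiteness can be claimed only for the state with this coordinate removed.\<close>

definition drop_ref :: "'m state \<Rightarrow> 'm state" where
  "drop_ref x = state_vec (theta_of x) (\<lambda>i. case i of None \<Rightarrow> 0 | Some k \<Rightarrow> omega_of x i) (volt_of x)"

lemma of_drop_ref [simp]:
  "theta_of (drop_ref x) i = theta_of x i"
  "omega_of (drop_ref x) None = 0"
  "omega_of (drop_ref x) (Some k) = omega_of x (Some k)"
  "volt_of (drop_ref x) i = volt_of x i"
  by (cases i; simp add: drop_ref_def)+

lemma hess_drop_ref [simp]:
  "hess_theta (drop_ref x) i = hess_theta x i"
  "hess_volt (drop_ref x) i = hess_volt x i"
  by (simp_all add: hess_theta_def hess_volt_def)

lemma drop_ref_eq_0D:
  assumes "drop_ref x = 0" "x \<noteq> 0"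
  shows "omega_of x None \<noteq> 0"
proof
  assume "omega_of x None = 0"
  then have "(\<lambda>i. case i of None \<Rightarrow> 0 | Some k \<Rightarrow> omega_of x i) = omega_of x"
    by (auto split: option.split)
  then have "drop_ref x = x" using state_vec_split[of x] by (simp add: drop_ref_def)
  then show False using assms by simp
qed

section \<open>Positivity and decay of the weighted form\<close>

lemma bounded_linear_lyap: "bounded_linear (lyap \<beta> \<kappa>)"
  unfolding lyap_def[abs_def]
proof (rule bounded_linear_state_vec)
  show "bounded_linear (\<lambda>x. inertia N i *
      (case i of None \<Rightarrow> \<kappa> * omega_of x i | Some k \<Rightarrow> omega_of x i + \<beta> * theta_of x i))" for i
    by (cases i) (auto intro!: bounded_linear_const_mult bounded_linear_add)
qed (auto intro!: bounded_linear_const_mult bounded_linear_add bounded_linear_hess_theta bounded_linear_hess_volt)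

lemma inner_lyap:
  "x \<bullet> lyap \<beta> \<kappa> y = x \<bullet> hess y
     + \<beta> * (\<Sum>k\<in>UNIV. inertia N (Some k) * (theta_of x (Some k) * omega_of y (Some k)
         + omega_of x (Some k) * theta_of y (Some k)))
     + (\<kappa> - 1) * (inertia N None * (omega_of x None * omega_of y None))"
  by (simp add: lyap_def hess_def inner_state sum_UNIV_option sum.distrib sum_distrib_left algebra_simps)

lemma lyap_symmetric: "x \<bullet> lyap \<beta> \<kappa> y = lyap \<beta> \<kappa> x \<bullet> y"
  unfolding inner_commute[of "lyap \<beta> \<kappa> x"] inner_lyap hess_symmetric[of x y]
  by (simp add: algebra_simps)

text \<open>At the other nodes the products of frequency and \<open>hess_theta\<close> cancel
  between the angle and frequency equations. The reference node has no angle equation, so its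
  product survives, with weight \<kappa>. The cross term contributes angle times
  \<open>hess_theta\<close>, at the price of a kinetic term that the damping must absorb.\<close>

lemma lyap_inner_jac:
  "- (lyap \<beta> \<kappa> x \<bullet> jac x) =
     (\<Sum>k\<in>UNIV. damping N (Some k) * (omega_of x (Some k))\<^sup>2)
       + (\<Sum>i\<in>UNIV. vs i / volt_time N i * (hess_volt x i)\<^sup>2)
     + \<beta> * (\<Sum>k\<in>UNIV. theta_of x (Some k) * (damping N (Some k) * omega_of x (Some k) + hess_theta x (Some k))
         - inertia N (Some k) * (omega_of x (Some k))\<^sup>2)
     + \<kappa> * (omega_of x None * (damping N None * omega_of x None + hess_theta x None))"
proof -
  define c where "c i = (case i of None \<Rightarrow> \<kappa> * omega_of x i
      | Some k \<Rightarrow> omega_of x i + \<beta> * theta_of x i)" for i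
  have m: "inertia N i * c i * ((- damping N i * omega_of x i - hess_theta x i) / inertia N i)
      = - (c i * (damping N i * omega_of x i + hess_theta x i))" for i
    using inertia_pos[of i] by (simp add: field_simps)
  show ?thesis
    unfolding lyap_def jac_def inner_state_vec c_def[symmetric] m sum_UNIV_option
    by (simp add: c_def sum.distrib sum_subtractf sum_negf sum_distrib_left
        power2_eq_square algebra_simps)
qed

lemma lyapunov_weights_exist:
  assumes pd: "\<And>x. x \<noteq> 0 \<Longrightarrow> 0 < x \<bullet> hess x"
  obtains \<beta> \<kappa> where "\<And>x. x \<noteq> 0 \<Longrightarrow> 0 < x \<bullet> lyap \<beta> \<kappa> x" "\<And>x. x \<noteq> 0 \<Longrightarrow> lyap \<beta> \<kappa> x \<bullet> jac x < 0"
proof -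
  note bl = bounded_linear_of_state bounded_linear_hess_theta bounded_linear_hess_volt
    bounded_linear_add bounded_linear_const_mult
  define R0 where "R0 x = (\<Sum>k\<in>UNIV. inertia N (Some k) * (theta_of x (Some k) * omega_of x (Some k)
         + omega_of x (Some k) * theta_of x (Some k)))" for x
  define P where "P x = (\<Sum>k\<in>UNIV. damping N (Some k) * (omega_of x (Some k))\<^sup>2)
       + (\<Sum>i\<in>UNIV. vs i / volt_time N i * (hess_volt x i)\<^sup>2)" for x
  define R where "R x = (\<Sum>k\<in>UNIV. theta_of x (Some k) *
       (damping N (Some k) * omega_of x (Some k) + hess_theta x (Some k))
         + (- inertia N (Some k)) * (omega_of x (Some k) * omega_of x (Some k)))" for x
  define T where "T x = omega_of x None * (damping N None * omega_of x None + hess_theta x None)" for x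
  have qR0: "quadratic_form R0"
    unfolding R0_def[abs_def]
    by (intro quadratic_form_sum quadratic_form_cmult quadratic_form_add quadratic_form_mult bl)
  have qP: "quadratic_form P"
    unfolding P_def[abs_def] power2_eq_square
    by (intro quadratic_form_sum quadratic_form_cmult quadratic_form_add quadratic_form_mult bl)
  have qR: "quadratic_form R"
    unfolding R_def[abs_def]
    by (intro quadratic_form_sum quadratic_form_cmult quadratic_form_add quadratic_form_mult bl)
  have qT: "quadratic_form T"
    unfolding T_def[abs_def]
    by (intro quadratic_form_mult bl)
  have qH: "quadratic_form (\<lambda>x. x \<bullet> hess x)"
    by (intro quadratic_form_inner bounded_linear_ident has_derivative_bounded_linear[OF hess_derivative])
  have qO: "quadratic_form (\<lambda>x. omega_of x None * omega_of x None)"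
    by (intro quadratic_form_mult bl)
  have pd0: "0 \<le> x \<bullet> hess x" for x
    using pd[of x] by (cases "x = 0") auto
  obtain b0 where b0: "b0 > 0" "\<And>c x. 0 < c \<Longrightarrow> c \<le> b0 \<Longrightarrow> x \<noteq> 0 \<Longrightarrow> 0 < x \<bullet> hess x + c * R0 x"
    using finsler_perturb_pos[OF qH qR0 pd0] pd by (metis less_irrefl)
  have P0: "0 \<le> P x" for x
    unfolding P_def using damping_pos vs_pos volt_time_pos
    by (intro add_nonneg_nonneg sum_nonneg mult_nonneg_nonneg divide_nonneg_pos) (auto simp: less_imp_le)
  \<comment> \<open>A state whose only nonzero coordinate is the reference frequency makes both
    \<open>P\<close> and \<open>R\<close> vanish. The added square excludes it for now and
    disappears again under \<open>drop_ref\<close>.\<close>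
  have PO0: "0 \<le> P x + omega_of x None * omega_of x None" for x
    using P0[of x] by simp
  have R_pos: "0 < R x" if "x \<noteq> 0" "P x + omega_of x None * omega_of x None = 0" for x
  proof -
    have "P x = 0" and None: "omega_of x None = 0"
      using that P0[of x] by (auto simp: add_nonneg_eq_0_iff)
    have d0: "0 \<le> damping N i * (omega_of x i)\<^sup>2" and v0: "0 \<le> vs i / volt_time N i * (hess_volt x i)\<^sup>2" for i
      using damping_pos[of i] vs_pos[of i] volt_time_pos[of i] by auto
    have "(\<Sum>k\<in>UNIV. damping N (Some k) * (omega_of x (Some k))\<^sup>2) = 0"
      "(\<Sum>i\<in>UNIV. vs i / volt_time N i * (hess_volt x i)\<^sup>2) = 0"
      using \<open>P x = 0\<close> sum_nonneg[of UNIV "\<lambda>k. damping N (Some k) * (omega_of x (Some k))\<^sup>2"]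
        sum_nonneg[of UNIV "\<lambda>i. vs i / volt_time N i * (hess_volt x i)\<^sup>2"] d0 v0
      unfolding P_def by (smt (verit))+
    then have "damping N (Some k) * (omega_of x (Some k))\<^sup>2 = 0" "vs i / volt_time N i * (hess_volt x i)\<^sup>2 = 0" for k i
      using d0 v0 by (simp_all add: sum_nonneg_eq_0_iff)
    then have om: "omega_of x (Some k) = 0" and hv: "hess_volt x i = 0" for k i
      using damping_pos[of "Some k"] vs_pos[of i] volt_time_pos[of i]
      by (metis less_irrefl mult_eq_0_iff power_eq_0_iff divide_eq_0_iff)+
    \<comment> \<open>Where the dissipation vanishes, only the pairing of the angles with
      \<open>hess_theta\<close> is left of the energy form, and it is exactly \<open>R\<close>.
      Positive definiteness of the Hessian thus becomes decay in the angles.\<close>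
    have "x \<bullet> hess x = R x"
      by (simp add: hess_def inner_state R_def om hv None sum_UNIV_option)
    then show ?thesis using pd[OF that(1)] by simp
  qed
  obtain b1 where b1: "b1 > 0" "\<And>c x. 0 < c \<Longrightarrow> c \<le> b1 \<Longrightarrow> x \<noteq> 0 \<Longrightarrow>
      0 < P x + omega_of x None * omega_of x None + c * R x"
    using finsler_perturb_pos[OF quadratic_form_add[OF qP qO] qR PO0 R_pos] by blast
  define \<beta> where "\<beta> = min b0 b1"
  have \<beta>: "\<beta> > 0" "\<beta> \<le> b0" "\<beta> \<le> b1" using b0 b1 by (auto simp: \<beta>_def)
  have drop: "P (drop_ref x) = P x" "R (drop_ref x) = R x" "R0 (drop_ref x) = R0 x" for x
    by (simp_all add: P_def R_def R0_def)
  have PR: "0 < P x + \<beta> * R x" if "drop_ref x \<noteq> 0" for x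
    using b1(2)[OF \<beta>(1,3) that] by (simp add: drop)
  have PR0: "P x + \<beta> * R x = 0" if "drop_ref x = 0" for x
  proof -
    have "P 0 + \<beta> * R 0 = 0"
      using qP qR unfolding quadratic_form_def by (metis mult_zero_left mult_zero_right add_0 scaleR_zero_left zero_power2)
    then show ?thesis using that drop[of x] by simp
  qed
  have "0 \<le> P x + \<beta> * R x" for x
    using PR[of x] PR0[of x] by (cases "drop_ref x = 0") auto
  \<comment> \<open>The zeros of \<open>P x + \<beta> * R x\<close> have only a reference frequency.
    There the reference force vanishes and the damping of the reference node makes \<open>T\<close>
    positive.\<close>
  moreover have "0 < T x" if "x \<noteq> 0" "P x + \<beta> * R x = 0" for x
  proof -
    have dx: "drop_ref x = 0" using PR[of x] that(2) by (cases "drop_ref x = 0") auto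
    have "hess_theta x None = hess_theta 0 None" using hess_drop_ref(1)[of x None] dx by simp
    also have "\<dots> = 0" by (simp add: hess_theta_def)
    finally have "T x = damping N None * (omega_of x None)\<^sup>2" by (simp add: T_def power2_eq_square)
    then show ?thesis
      using drop_ref_eq_0D[OF dx that(1)] damping_pos[of None] by simp
  qed
  ultimately obtain \<kappa> where \<kappa>: "\<kappa> > 0" "\<And>c x. 0 < c \<Longrightarrow> c \<le> \<kappa> \<Longrightarrow> x \<noteq> 0 \<Longrightarrow> 0 < P x + \<beta> * R x + c * T x"
    using finsler_perturb_pos[OF quadratic_form_add[OF qP quadratic_form_cmult[OF qR]] qT] by metis
  show ?thesis
  proof (rule that)
    fix x :: "'m state"
    assume x: "x \<noteq> 0"
    have "lyap \<beta> \<kappa> x \<bullet> jac x = - (P x + \<beta> * R x + \<kappa> * T x)"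
      using lyap_inner_jac[of \<beta> \<kappa> x] by (simp add: P_def R_def T_def power2_eq_square algebra_simps)
    then show "lyap \<beta> \<kappa> x \<bullet> jac x < 0" using \<kappa>(2)[OF \<kappa>(1) order_refl x] by simp
    \<comment> \<open>Splitting off the reference frequency leaves the form already made positive by
      the choice of \<beta>, so any positive \<kappa> suffices here.\<close>
    have eq: "x \<bullet> lyap \<beta> \<kappa> x = (drop_ref x \<bullet> hess (drop_ref x) + \<beta> * R0 (drop_ref x))
        + \<kappa> * (inertia N None * (omega_of x None)\<^sup>2)"
      unfolding inner_lyap R0_def[symmetric] drop
      by (simp add: hess_def inner_state sum_UNIV_option power2_eq_square algebra_simps)
    show "0 < x \<bullet> lyap \<beta> \<kappa> x"
    proof (cases "drop_ref x = 0")
      case True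
      then have "x \<bullet> lyap \<beta> \<kappa> x = \<kappa> * (inertia N None * (omega_of x None)\<^sup>2)"
        unfolding eq by (simp add: R0_def)
      then show ?thesis
        using drop_ref_eq_0D[OF True x] \<kappa>(1) inertia_pos[of None] by simp
    next
      case False
      have "0 \<le> \<kappa> * (inertia N None * (omega_of x None)\<^sup>2)"
        using \<kappa>(1) inertia_pos[of None] by simp
      then show ?thesis
        unfolding eq using b0(2)[OF \<beta>(1,2) False] by linarith
    qed
  qed
qed

end

theorem theoremV7:
  fixes N :: "'m::finite option power_network"
    and \<theta>s \<omega>s vs :: "'m option \<Rightarrow> real"
    and L r :: real
  assumes tree: "hierarchical_tree N"
    and ref_node: "None \<in> L3 N"
    and no_line: "\<And>i j. (i, j) \<notin> edges N \<Longrightarrow> suscept N i j = 0"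
    and sync: "synchronous_state N \<theta>s \<omega>s vs"
    and connected: "(edges N)\<^sup>* = UNIV"
    and suscept_sym_pos:
      "\<And>i j. (i, j) \<in> edges N \<Longrightarrow> suscept N i j = suscept N j i \<and> suscept N i j > 0"
    and suscept_diag: "\<And>i. suscept N i i = 0"
    and lossless: "\<And>i j. conduct N i j = 0"
    and angle_diff: "\<And>i j. (i, j) \<in> edges N \<Longrightarrow> \<bar>\<theta>s i - \<theta>s j\<bar> < pi / 2"
    and params_pos:
      "\<And>i. inertia N i > 0 \<and> damping N i > 0 \<and> volt_time N i > 0 \<and> volt_droop N i > 0 \<and> vs i > 0"
    and inertia_levels:
      "\<And>i j k. i \<in> L5 N \<Longrightarrow> j \<in> L4 N \<Longrightarrow> k \<in> L3 N \<Longrightarrow>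
         inertia N i > inertia N j \<and> inertia N j > inertia N k"
    and L_pos: "L > 0"
    and energy_well_defined:
      "\<And>x i. x \<in> cball (0 :: 'm state) r \<Longrightarrow> vs i + volt_of x i > 0"
    and hessian_lipschitz:
      "\<And>x y. x \<in> cball 0 r \<Longrightarrow> y \<in> cball 0 r \<Longrightarrow>
         onorm ((*v) (hessian (energy N \<theta>s vs) x - hessian (energy N \<theta>s vs) y))
           \<le> L * norm (x - y)"
    and margin: "coupling_C N \<theta>s vs > coupling_C1 N \<theta>s vs" "coupling_C1 N \<theta>s vs > 0"
    and radius: "0 < r" "r < 3 * lambda_min (hessian (energy N \<theta>s vs) 0) / L"
  shows "\<forall>\<epsilon>>0. \<exists>\<delta>>0. \<forall>x0 :: 'm state.
           norm (x0 - state_vec \<theta>s \<omega>s vs) < \<delta> \<longrightarrow>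
             (\<exists>x. solution_from N \<theta>s \<omega>s vs x0 x) \<and>
             (\<forall>x. solution_from N \<theta>s \<omega>s vs x0 x \<longrightarrow>
                (\<forall>t>0. norm (x t - state_vec \<theta>s \<omega>s vs) < \<epsilon>) \<and>
                (x \<longlongrightarrow> state_vec \<theta>s \<omega>s vs) at_top)"
proof (intro allI impI)
  fix \<epsilon> :: real
  assume "\<epsilon> > 0"
  have sym: "suscept N i j = suscept N j i" for i j
  proof (cases "(i, j) \<in> edges N")
    case False
    then have "(j, i) \<notin> edges N" using tree by (auto simp: hierarchical_tree_def dest: symD)
    then show ?thesis using no_line False by simp
  qed (use suscept_sym_pos in blast)
  have nbrs: "(\<Sum>j\<in>UNIV. F j) = (\<Sum>j\<in>nbrs N i. F j)" if "\<And>j. suscept N i j = 0 \<Longrightarrow> F j = 0"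
    for F :: "'m option \<Rightarrow> real" and i
  proof (rule sum.mono_neutral_right)
    have "suscept N i j = 0" if "j \<notin> nbrs N i" for j
      using that no_line[of j i] sym[of i j] by (simp add: nbrs_def)
    then show "\<forall>j\<in>UNIV - nbrs N i. F j = 0" using that by blast
  qed auto
  interpret power_grid N \<theta>s vs
  proof
    show "(\<Sum>j\<in>UNIV. flowP N \<theta>s vs i j) = netP N i" for i
      using sync nbrs[of i "flowP N \<theta>s vs i"] by (simp add: synchronous_state_def flowP_def lossless)
    show "(\<Sum>j\<in>UNIV. flowQ N \<theta>s vs i j) = netQ N i - volt_droop N i * vs i" for i
      using sync nbrs[of i "flowQ N \<theta>s vs i"] by (simp add: synchronous_state_def flowQ_def lossless)
  qed (use sym no_line tree lossless params_pos in auto)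
  have "0 < 3 * lambda_min (hessian (energy N \<theta>s vs) 0) / L" using radius by linarith
  then have lam: "0 < lambda_min (hessian (energy N \<theta>s vs) 0)"
    using L_pos by (simp add: zero_less_divide_iff)
  have "0 < x \<bullet> hess x" if "x \<noteq> 0" for x
    using symmetric_pos_def[OF _ lam that] hess_symmetric
    by (simp add: hessian_energy_mult inner_commute)
  then obtain \<beta> \<kappa> where pos: "\<And>x. x \<noteq> 0 \<Longrightarrow> 0 < x \<bullet> lyap \<beta> \<kappa> x"
    and neg: "\<And>x. x \<noteq> 0 \<Longrightarrow> lyap \<beta> \<kappa> x \<bullet> jac x < 0"
    using lyapunov_weights_exist by blast
  \<comment> \<open>The radius 1 is arbitrary, since the vector field is Lipschitz on every bounded
    set.\<close>
  obtain K where K: "K-lipschitz_on (cball 0 1) (vector_field N \<theta>s vs)"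
    using vector_field_lipschitz[OF bounded_cball] by blast
  let ?s = "state_vec \<theta>s \<omega>s vs :: 'm state"
  let ?sol = "\<lambda>y. \<forall>t\<ge>0. (y has_vector_derivative vector_field N \<theta>s vs (y t)) (at t within {0..})"
  obtain \<delta> where "\<delta> > 0"
    and exist: "\<And>y0. norm y0 < \<delta> \<Longrightarrow> \<exists>y. y 0 = y0 \<and> ?sol y"
    and stable: "\<And>y t. norm (y 0) < \<delta> \<Longrightarrow> ?sol y \<Longrightarrow> t \<ge> 0 \<Longrightarrow> norm (y t) < \<epsilon>"
    and attract: "\<And>y. norm (y 0) < \<delta> \<Longrightarrow> ?sol y \<Longrightarrow> (y \<longlongrightarrow> 0) at_top"
    by (rule linearised_lyapunov_stability[OF vector_field_0 vector_field_derivative K zero_less_one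
          bounded_linear_lyap lyap_symmetric pos neg \<open>\<epsilon> > 0\<close>]) blast+
  show "\<exists>\<delta>>0. \<forall>x0 :: 'm state. norm (x0 - ?s) < \<delta> \<longrightarrow>
      (\<exists>x. solution_from N \<theta>s \<omega>s vs x0 x) \<and>
      (\<forall>x. solution_from N \<theta>s \<omega>s vs x0 x \<longrightarrow>
        (\<forall>t>0. norm (x t - ?s) < \<epsilon>) \<and> (x \<longlongrightarrow> ?s) at_top)"
  proof (intro exI[of _ \<delta>] conjI allI impI)
    show "\<delta> > 0" by fact
    fix x0 :: "'m state"
    assume x0: "norm (x0 - ?s) < \<delta>"
    obtain y where "y 0 = x0 - ?s" "?sol y" using exist[OF x0] by blast
    then have "solution_from N \<theta>s \<omega>s vs x0 (\<lambda>t. y t + ?s)"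
      by (simp add: solution_from_def)
    then show "\<exists>x. solution_from N \<theta>s \<omega>s vs x0 x" by blast
    fix x
    assume x: "solution_from N \<theta>s \<omega>s vs x0 x"
    then have sol: "?sol (\<lambda>t. x t - ?s)" and init: "norm (x 0 - ?s) < \<delta>"
      using x0 by (auto simp: solution_from_def)
    show "norm (x t - ?s) < \<epsilon>" if "t > 0" for t
      using stable[of "\<lambda>t. x t - ?s" t] sol init that by simp
    show "(x \<longlongrightarrow> ?s) at_top"
      using attract[of "\<lambda>t. x t - ?s"] sol init by (simp add: LIM_zero_iff)
  qed
qed

end
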